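(* Let $f:\mathbb{R}^d\to\mathbb{R}$ be differentiable, $\mu$-strongly convex with $\mu>0$, and $\mathbf{L}$-smooth with a symmetric positive definite matrix $\mathbf{L}\succ0$; let $\psi:\mathbb{R}^d\to\mathbb{R}\cup\{+\infty\}$ be proper, closed and convex. Let $\omega\ge0$, $\mathbf{\Omega}\succeq0$ symmetric, $\mathcal{C}_\omega\in\mathbb{B}^d(\omega)$, $\mathcal{C}_{\mathbf{\Omega}}\in\mathbb{B}^d(\mathbf{\Omega})$, and $$\delta=1-\frac{1}{1+\lambda_{\min}(\mathbf{\Omega})}\left(1-\frac{1}{(1+\omega)^2}\right),\qquad \widetilde{\mathbf{\Omega}}=\mathbf{I}+\omega(\omega+2)\,\mathbf{\Omega}(\mathbf{I}+\mathbf{\Omega})^{-1}.$$ Let $\{x_t\}$ be the iterates of the VR-GradSkip+ algorithm, run with gradient estimators $g_t$ satisfying the gradient-estimator assumption (stated in the context) with constants $A,B,C,\tilde A,\tilde B,\tilde C\ge0$, $\tilde B<1$, and sequence $\{\sigma_t\}_{t\ge0}$. If $B>0$, choose any $$W>\frac{\lambda_{\max}(\mathbf{L}\widetilde{\mathbf{\Omega}})B}{1-\tilde B}\quad\text{and set}\quad \beta=1-\tilde B-\frac{\lambda_{\max}(\mathbf{L}\widetilde{\mathbf{\Omega}})B}{W}>0;$$ if $B=0$, set $W=0$ and $\beta=1-\tilde B$. If the stepsize $\gamma>0$ satisfies $$\gamma\le\frac{1}{A\lambda_{\max}(\mathbf{L}\widetilde{\mathbf{\Omega}})+W\tilde A},$$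 then for all $t\ge0$ $$\mathbb{E}[\Psi_t]\le\left(1-\min\{\gamma\mu,\delta,\beta\}\right)^t\Psi_0+\gamma^2\,\frac{\lambda_{\max}(\mathbf{L}\widetilde{\mathbf{\Omega}})C+W\tilde C}{\min\{\gamma\mu,\delta,\beta\}},$$ where $\Psi_t:=\|x_t-x_\star\|^2+\gamma^2(1+\omega)^2\|h_t-h_\star\|^2+\gamma^2W\sigma_t$.
   Context: Notation: $\mathbf{I}$ is the identity matrix; $\|x\|_{\mathbf{M}}^2:=x^\top\mathbf{M}x$; $\lambda_{\max},\lambda_{\min}$ denote largest and smallest eigenvalue (the eigenvalues of $\mathbf{L}\widetilde{\mathbf{\Omega}}$ are real and positive). $D_f(x,y):=f(x)-f(y)-\langle\nabla f(y),x-y\rangle$. The function $f$ is $\mu$-strongly convex if $D_f(x,y)\ge\frac{\mu}{2}\|x-y\|^2$ for all $x,y$, and $\mathbf{L}$-smooth if $D_f(x,y)\le\frac12\|x-y\|_{\mathbf{L}}^2$ for all $x,y$. $\mathrm{prox}_{g}(x):=\arg\min_{u}\{g(u)+\frac12\|u-x\|^2\}$. The point $x_\star$ is the unique minimizer of $f+\psi$ and $h_\star:=\nabla f(x_\star)$. A bound of the form $\gamma\le 1/0$ is read as no restriction. Compressors: for symmetric $\mathbf{\Omega}\succeq0$, $\mathbb{B}^d(\mathbf{\Omega})$ is the class of (possibly randomized) operators $\mathcal{C}:\mathbb{R}^d\to\mathbb{R}^d$ with $\mathbb{E}[\mathcal{C}(x)]=x$ and $\mathbb{E}\left[\|(\mathbf{I}+\mathbf{\Omega})^{-1}\mathcal{C}(x)\|^2\right]\le\|x\|^2_{(\mathbf{I}+\mathbf{\Omega})^{-1}}$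 for all $x\in\mathbb{R}^d$. For a scalar $\omega\ge0$, $\mathbb{B}^d(\omega)$ is the class of (possibly randomized) $\mathcal{C}$ with $\mathbb{E}[\mathcal{C}(x)]=x$ and $\mathbb{E}[\|\mathcal{C}(x)\|^2]\le(1+\omega)\|x\|^2$ for all $x$. VR-GradSkip+ algorithm. Input: stepsize $\gamma>0$, $\mathcal{C}_\omega\in\mathbb{B}^d(\omega)$, $\mathcal{C}_{\mathbf{\Omega}}\in\mathbb{B}^d(\mathbf{\Omega})$, deterministic $x_0,h_0\in\mathbb{R}^d$. Each application of a compressor uses fresh randomness independent of everything else. For $t=0,1,2,\dots$: (1) obtain a random vector $g_t\in\mathbb{R}^d$ (stochastic gradient estimator of $\nabla f(x_t)$); (2) $\hat h_{t+1}=g_t-(\mathbf{I}+\mathbf{\Omega})^{-1}\mathcal{C}_{\mathbf{\Omega}}(g_t-h_t)$; (3) $\hat x_{t+1}=x_t-\gamma(g_t-\hat h_{t+1})$; (4) $\hat g_t=\frac{1}{\gamma(1+\omega)}\mathcal{C}_\omega\left(\hat x_{t+1}-\mathrm{prox}_{\gamma(1+\omega)\psi}(\hat x_{t+1}-\gamma(1+\omega)\hat h_{t+1})\right)$; (5) $x_{t+1}=\hat x_{t+1}-\gamma\hat g_t$; (6) $h_{t+1}=\hat h_{t+1}+\frac{1}{\gamma(1+\omega)}(x_{t+1}-\hat x_{t+1})$. Gradient-estimator assumption: for all $t\ge0$, $\mathbb{E}[g_t\mid x_t]=\nabla f(x_t)$, and for non-negative constants $A,B,C,\tilde A,\tilde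 B,\tilde C$ with $\tilde B<1$ and a non-negative (possibly random) sequence $\{\sigma_t\}_{t\ge0}$ with $\sigma_0$ deterministic, for all $t\ge0$, $$\mathbb{E}\left[\|g_t-\nabla f(x_\star)\|^2_{\mathbf{L}^{-1}}\mid x_t\right]\le 2A\,D_f(x_t,x_\star)+B\sigma_t+C,$$ $$\mathbb{E}[\sigma_{t+1}\mid x_t]\le 2\tilde A\,D_f(x_t,x_\star)+\tilde B\sigma_t+\tilde C .$$ *)

theory Defs
  imports "HOL-Probability.Probability"
begin

section \<open>Matrices over the reals\<close>

definition sym_mat :: "real^'n^'n \<Rightarrow> bool" where
  "sym_mat A \<longleftrightarrow> transpose A = A"

definition psd_mat :: "real^'n^'n \<Rightarrow> bool" where
  "psd_mat A \<longleftrightarrow> (\<forall>v. 0 \<le> v \<bullet> (A *v v))"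

definition pd_mat :: "real^'n^'n \<Rightarrow> bool" where
  "pd_mat A \<longleftrightarrow> (\<forall>v. v \<noteq> 0 \<longrightarrow> 0 < v \<bullet> (A *v v))"

definition sqnorm_wrt :: "real^'n^'n \<Rightarrow> real^'n \<Rightarrow> real" where
  "sqnorm_wrt A x = x \<bullet> (A *v x)"

text \<open>Only real eigenvalues are collected.  All matrices below whose extreme eigenvalues are
  taken (a symmetric matrix, or a product of two symmetric positive definite matrices) have a
  real spectrum, so nothing is lost.\<close>

definition eigenvals :: "real^'n^'n \<Rightarrow> real set" where
  "eigenvals A = {l. \<exists>v. v \<noteq> 0 \<and> A *v v = l *\<^sub>R v}"

definition lambda_max :: "real^'n^'n \<Rightarrow> real" where
  "lambda_max A = Max (eigenvals A)"

definition lambda_min :: "real^'n^'n \<Rightarrow> real" where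
  "lambda_min A = Min (eigenvals A)"


section \<open>Convex analysis\<close>

text \<open>In what follows \<open>gf\<close> is the gradient of \<open>f\<close>.\<close>

definition bregman ::
  "(real^'n \<Rightarrow> real) \<Rightarrow> (real^'n \<Rightarrow> real^'n) \<Rightarrow> real^'n \<Rightarrow> real^'n \<Rightarrow> real" where
  "bregman f gf x y = f x - f y - gf y \<bullet> (x - y)"

definition strongly_convex ::
  "real \<Rightarrow> (real^'n \<Rightarrow> real) \<Rightarrow> (real^'n \<Rightarrow> real^'n) \<Rightarrow> bool" where
  "strongly_convex \<mu> f gf \<longleftrightarrow> (\<forall>x y. bregman f gf x y \<ge> \<mu> / 2 * (norm (x - y))\<^sup>2)"

definition mat_smooth ::
  "real^'n^'n \<Rightarrow> (real^'n \<Rightarrow> real) \<Rightarrow> (real^'n \<Rightarrow> real^'n) \<Rightarrow> bool" where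
  "mat_smooth L f gf \<longleftrightarrow> (\<forall>x y. bregman f gf x y \<le> 1 / 2 * sqnorm_wrt L (x - y))"

definition ext_epigraph :: "(real^'n \<Rightarrow> ereal) \<Rightarrow> ((real^'n) \<times> real) set" where
  "ext_epigraph \<psi> = {(x, r). \<psi> x \<le> ereal r}"

definition proper_closed_convex :: "(real^'n \<Rightarrow> ereal) \<Rightarrow> bool" where
  "proper_closed_convex \<psi> \<longleftrightarrow>
     (\<forall>x. \<psi> x \<noteq> -\<infinity>) \<and> (\<exists>x. \<psi> x \<noteq> \<infinity>) \<and>
     closed (ext_epigraph \<psi>) \<and> convex (ext_epigraph \<psi>)"

definition prox :: "(real^'n \<Rightarrow> ereal) \<Rightarrow> real^'n \<Rightarrow> real^'n" where
  "prox \<psi> x = arg_min (\<lambda>u. \<psi> u + ereal (1 / 2 * (norm (u - x))\<^sup>2)) (\<lambda>_. True)"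


section \<open>Compressors\<close>

text \<open>A randomized operator is a map \<open>C s x\<close> of a random seed \<open>s\<close>, distributed according to a
  probability measure \<open>S\<close>, and of the argument \<open>x\<close>.  A second moment is a nonnegative integral
  in \<open>ennreal\<close>, so that bounding it includes its finiteness.\<close>

definition randomized_operator ::
  "'s measure \<Rightarrow> ('s \<Rightarrow> real^'n \<Rightarrow> real^'n) \<Rightarrow> bool" where
  "randomized_operator S C \<longleftrightarrow>
     prob_space S \<and> (\<lambda>(s, x). C s x) \<in> borel_measurable (S \<Otimes>\<^sub>M borel)"

definition unbiased_operator ::
  "'s measure \<Rightarrow> ('s \<Rightarrow> real^'n \<Rightarrow> real^'n) \<Rightarrow> bool" where
  "unbiased_operator S C \<longleftrightarrow>
     (\<forall>x. integrable S (\<lambda>s. C s x) \<and> (\<integral>s. C s x \<partial>S) = x)"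

definition scalar_compressor ::
  "real \<Rightarrow> 's measure \<Rightarrow> ('s \<Rightarrow> real^'n \<Rightarrow> real^'n) \<Rightarrow> bool" where
  "scalar_compressor \<omega> S C \<longleftrightarrow>
     randomized_operator S C \<and> unbiased_operator S C \<and>
     (\<forall>x. (\<integral>\<^sup>+s. ennreal ((norm (C s x))\<^sup>2) \<partial>S) \<le> ennreal ((1 + \<omega>) * (norm x)\<^sup>2))"

definition matrix_compressor ::
  "real^'n^'n \<Rightarrow> 's measure \<Rightarrow> ('s \<Rightarrow> real^'n \<Rightarrow> real^'n) \<Rightarrow> bool" where
  "matrix_compressor \<Omega> S C \<longleftrightarrow>
     randomized_operator S C \<and> unbiased_operator S C \<and>
     (\<forall>x. (\<integral>\<^sup>+s. ennreal ((norm (matrix_inv (mat 1 + \<Omega>) *v C s x))\<^sup>2) \<partial>S)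
            \<le> ennreal (sqnorm_wrt (matrix_inv (mat 1 + \<Omega>)) x))"


section \<open>Conditional expectation and freshness of randomness\<close>

definition gen_algebra :: "'a measure \<Rightarrow> 'b measure \<Rightarrow> ('a \<Rightarrow> 'b) \<Rightarrow> 'a measure" where
  "gen_algebra M N X = vimage_algebra (space M) X N"

text \<open>\<open>Y\<close> is (a version of) the conditional expectation of the random vector \<open>X\<close> given the
  sub-sigma-algebra \<open>F\<close>; conditional expectations of vectors are taken componentwise.\<close>

definition is_cond_exp ::
  "'a measure \<Rightarrow> 'a measure \<Rightarrow> ('a \<Rightarrow> real^'n) \<Rightarrow> ('a \<Rightarrow> real^'n) \<Rightarrow> bool" where
  "is_cond_exp M F X Y \<longleftrightarrow>
     integrable M X \<and>
     (\<forall>i. AE w in M. real_cond_exp M F (\<lambda>w. X w $ i) w = Y w $ i)"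

text \<open>In iteration \<open>t\<close> the seed \<open>\<xi> t\<close> is used for the matrix compressor and, after it, the seed
  \<open>\<eta> t\<close> for the scalar compressor.  \<open>past_events\<close> is the sigma-algebra of everything that is
  drawn before \<open>\<xi> t\<close>; the iterates up to time \<open>t\<close> are functions of these data.\<close>

definition past_events ::
  "'a measure \<Rightarrow> 's measure \<Rightarrow> 'r measure \<Rightarrow> (nat \<Rightarrow> 'a \<Rightarrow> real^'n) \<Rightarrow> (nat \<Rightarrow> 'a \<Rightarrow> real) \<Rightarrow>
   (nat \<Rightarrow> 'a \<Rightarrow> 's) \<Rightarrow> (nat \<Rightarrow> 'a \<Rightarrow> 'r) \<Rightarrow> nat \<Rightarrow> 'a set set" where
  "past_events M S R g \<sigma> \<xi> \<eta> t =
     sigma_sets (space M)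
       ((\<Union>k\<le>t. sets (gen_algebra M borel (g k)) \<union> sets (gen_algebra M borel (\<sigma> k))) \<union>
        (\<Union>k<t. sets (gen_algebra M S (\<xi> k)) \<union> sets (gen_algebra M R (\<eta> k))))"

definition fresh_seeds ::
  "'a measure \<Rightarrow> 's measure \<Rightarrow> 'r measure \<Rightarrow> (nat \<Rightarrow> 'a \<Rightarrow> real^'n) \<Rightarrow> (nat \<Rightarrow> 'a \<Rightarrow> real) \<Rightarrow>
   (nat \<Rightarrow> 'a \<Rightarrow> 's) \<Rightarrow> (nat \<Rightarrow> 'a \<Rightarrow> 'r) \<Rightarrow> bool" where
  "fresh_seeds M S R g \<sigma> \<xi> \<eta> \<longleftrightarrow>
     (\<forall>t. \<xi> t \<in> measurable M S \<and> distr M S (\<xi> t) = S \<and>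
          \<eta> t \<in> measurable M R \<and> distr M R (\<eta> t) = R \<and>
          prob_space.indep_set M
            (sets (gen_algebra M S (\<xi> t)))
            (past_events M S R g \<sigma> \<xi> \<eta> t) \<and>
          prob_space.indep_set M
            (sets (gen_algebra M R (\<eta> t)))
            (sigma_sets (space M)
               (past_events M S R g \<sigma> \<xi> \<eta> t \<union> sets (gen_algebra M S (\<xi> t)))))"


section \<open>The VR-GradSkip+ algorithm\<close>

text \<open>One iteration with the two compressor realizations \<open>Cm\<close> (matrix) and \<open>Cs\<close> (scalar)
  held fixed; \<open>g\<close> is the gradient estimator and \<open>(x, h)\<close> the current state.\<close>

definition vr_gradskip_step ::
  "real \<Rightarrow> real \<Rightarrow> real^'n^'n \<Rightarrow> (real^'n \<Rightarrow> ereal) \<Rightarrow>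
   (real^'n \<Rightarrow> real^'n) \<Rightarrow> (real^'n \<Rightarrow> real^'n) \<Rightarrow> real^'n \<Rightarrow>
   (real^'n) \<times> (real^'n) \<Rightarrow> (real^'n) \<times> (real^'n)" where
  "vr_gradskip_step \<gamma> \<omega> \<Omega> \<psi> Cm Cs g = (\<lambda>(x, h).
     let hhat = g - matrix_inv (mat 1 + \<Omega>) *v Cm (g - h);
         xhat = x - \<gamma> *\<^sub>R (g - hhat);
         ghat = (1 / (\<gamma> * (1 + \<omega>))) *\<^sub>R
                  Cs (xhat - prox (\<lambda>u. ereal (\<gamma> * (1 + \<omega>)) * \<psi> u)
                                  (xhat - (\<gamma> * (1 + \<omega>)) *\<^sub>R hhat));
         x' = xhat - \<gamma> *\<^sub>R ghat;
         h' = hhat + (1 / (\<gamma> * (1 + \<omega>))) *\<^sub>R (x' - xhat)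
     in (x', h'))"

definition vr_gradskip_run ::
  "'a measure \<Rightarrow> real \<Rightarrow> real \<Rightarrow> real^'n^'n \<Rightarrow> (real^'n \<Rightarrow> ereal) \<Rightarrow>
   ('s \<Rightarrow> real^'n \<Rightarrow> real^'n) \<Rightarrow> ('r \<Rightarrow> real^'n \<Rightarrow> real^'n) \<Rightarrow>
   (nat \<Rightarrow> 'a \<Rightarrow> 's) \<Rightarrow> (nat \<Rightarrow> 'a \<Rightarrow> 'r) \<Rightarrow> (nat \<Rightarrow> 'a \<Rightarrow> real^'n) \<Rightarrow>
   real^'n \<Rightarrow> real^'n \<Rightarrow> (nat \<Rightarrow> 'a \<Rightarrow> real^'n) \<Rightarrow> (nat \<Rightarrow> 'a \<Rightarrow> real^'n) \<Rightarrow> bool" where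
  "vr_gradskip_run M \<gamma> \<omega> \<Omega> \<psi> Cm Cs \<xi> \<eta> g x0 h0 x h \<longleftrightarrow>
     (\<forall>w\<in>space M. x 0 w = x0 \<and> h 0 w = h0 \<and>
        (\<forall>t. (x (Suc t) w, h (Suc t) w) =
               vr_gradskip_step \<gamma> \<omega> \<Omega> \<psi> (Cm (\<xi> t w)) (Cs (\<eta> t w)) (g t w) (x t w, h t w)))"

text \<open>Conditional expectations given \<open>x t\<close> of nonnegative quantities are taken in \<open>ennreal\<close>
  (\<open>nn_cond_exp\<close>), so that the bounds include finiteness.\<close>

definition gradient_estimator ::
  "'a measure \<Rightarrow> (real^'n \<Rightarrow> real) \<Rightarrow> (real^'n \<Rightarrow> real^'n) \<Rightarrow> real^'n^'n \<Rightarrow> real^'n \<Rightarrow>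
   real \<Rightarrow> real \<Rightarrow> real \<Rightarrow> real \<Rightarrow> real \<Rightarrow> real \<Rightarrow>
   (nat \<Rightarrow> 'a \<Rightarrow> real^'n) \<Rightarrow> (nat \<Rightarrow> 'a \<Rightarrow> real^'n) \<Rightarrow> (nat \<Rightarrow> 'a \<Rightarrow> real) \<Rightarrow> real \<Rightarrow> bool" where
  "gradient_estimator M f gf L xs A B C At Bt Ct x g \<sigma> \<sigma>0 \<longleftrightarrow>
     (\<forall>t. g t \<in> borel_measurable M \<and> \<sigma> t \<in> borel_measurable M) \<and>
     (\<forall>t. \<forall>w\<in>space M. 0 \<le> \<sigma> t w) \<and>
     (\<forall>w\<in>space M. \<sigma> 0 w = \<sigma>0) \<and>
     (\<forall>t. is_cond_exp M (gen_algebra M borel (x t)) (g t) (\<lambda>w. gf (x t w))) \<and>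
     (\<forall>t. AE w in M.
        nn_cond_exp M (gen_algebra M borel (x t))
            (\<lambda>w. ennreal (sqnorm_wrt (matrix_inv L) (g t w - gf xs))) w
          \<le> ennreal (2 * A * bregman f gf (x t w) xs + B * \<sigma> t w + C)) \<and>
     (\<forall>t. AE w in M.
        nn_cond_exp M (gen_algebra M borel (x t)) (\<lambda>w. ennreal (\<sigma> (Suc t) w)) w
          \<le> ennreal (2 * At * bregman f gf (x t w) xs + Bt * \<sigma> t w + Ct))"

definition lyapunov ::
  "real \<Rightarrow> real \<Rightarrow> real \<Rightarrow> real^'n \<Rightarrow> real^'n \<Rightarrow> real^'n \<Rightarrow> real^'n \<Rightarrow> real \<Rightarrow> real" where
  "lyapunov \<gamma> \<omega> W xs hs x h s =
     (norm (x - xs))\<^sup>2 + \<gamma>\<^sup>2 * (1 + \<omega>)\<^sup>2 * (norm (h - hs))\<^sup>2 + \<gamma>\<^sup>2 * W * s"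

end

theory Submission
  imports Defs
begin

text \<open>
  Let \<open>\<tau> = \<gamma> (1 + \<omega>)\<close>.  Averaging over the scalar compressor, firm nonexpansiveness of the proximal
  map bounds the mean of \<open>\<parallel>x' - xs\<parallel>\<^sup>2 + \<tau>\<^sup>2 \<parallel>h' - hs\<parallel>\<^sup>2\<close> by
  \<open>\<parallel>xhat - xs\<parallel>\<^sup>2 + \<tau>\<^sup>2 \<parallel>hhat - hs\<parallel>\<^sup>2 - 2 \<gamma> (xhat - xs) \<bullet> (hhat - hs)\<close>, which is
  \<open>\<parallel>x - xs - \<gamma> (g - hs)\<parallel>\<^sup>2 + \<gamma>\<^sup>2 \<omega> (\<omega> + 2) \<parallel>hhat - hs\<parallel>\<^sup>2\<close>: its first term no longer contains the
  matrix compressor.  Averaging over the latter, with \<open>Q = (I + \<Omega>)\<^sup>-\<^sup>1\<close>, bounds \<open>\<parallel>hhat - hs\<parallel>\<^sup>2\<close> by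
  the \<open>(I - Q)\<close>-norm of \<open>g - hs\<close> plus the \<open>Q\<close>-norm of \<open>h - hs\<close>.  The first joins
  \<open>\<gamma>\<^sup>2 \<parallel>g - hs\<parallel>\<^sup>2\<close> to form the \<open>\<Omega>t\<close>-norm, at most \<open>lam\<close> times the norm of the estimator
  assumption; the second contracts by \<open>1 - \<delta>\<close>.  Strong convexity controls the remaining
  cross term, and the stepsize condition makes the coefficient of the Bregman divergence nonpositive.

  All steps up to the cross term concern nonnegative integrands, so they need no integrability of the
  iterates; that follows by induction along with the recursion.
\<close>

subsection \<open>Extreme eigenvalues\<close>

lemma sym_mat_inner:
  fixes A :: "real^'n^'n"
  assumes "sym_mat A"
  shows "(A *v x) \<bullet> y = x \<bullet> (A *v y)"
proof -
  have "A *v x = x v* A"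
    using transpose_matrix_vector[of A x] assms unfolding sym_mat_def by (simp only:)
  then show ?thesis by (simp only: dot_lmul_matrix)
qed

text \<open>Along \<open>v + t *\<^sub>R (A *v v)\<close> the form is a polynomial in
  \<open>t\<close> without constant term. As it is nonnegative for all \<open>t\<close>, its linear
  coefficient vanishes, and that coefficient is twice the squared norm of
  \<open>A *v v\<close>.\<close>

lemma psd_form_zero_imp_kernel:
  fixes A :: "real^'n^'n"
  assumes sym: "sym_mat A" and psd: "psd_mat A" and zero: "v \<bullet> (A *v v) = 0"
  shows "A *v v = 0"
proof -
  let ?w = "A *v v"
  have pos: "0 \<le> 2 * t * (?w \<bullet> ?w) + t\<^sup>2 * (?w \<bullet> (A *v ?w))" for t
  proof -
    have "0 \<le> (v + t *\<^sub>R ?w) \<bullet> (A *v (v + t *\<^sub>R ?w))"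
      using psd by (simp add: psd_mat_def)
    also have "\<dots> = 2 * t * (?w \<bullet> ?w) + t\<^sup>2 * (?w \<bullet> (A *v ?w))"
      using zero sym_mat_inner[OF sym, of v ?w]
      by (simp add: matrix_vector_right_distrib matrix_vector_mult_scaleR inner_add_left
          inner_add_right power2_eq_square algebra_simps)
    finally show ?thesis .
  qed
  define a where "a = ?w \<bullet> ?w"
  define b where "b = ?w \<bullet> (A *v ?w)"
  have "a \<ge> 0" "b \<ge> 0" using psd by (auto simp: a_def b_def psd_mat_def)
  have "a = 0"
  proof (rule ccontr)
    assume "a \<noteq> 0"
    with \<open>a \<ge> 0\<close> have "a > 0" by simp
    \<comment> \<open>At \<open>t = - (a / c)\<close> the polynomial equals
      \<open>(a / c)\<^sup>2 * (b - 2 * c)\<close>; the choice \<open>b + 1\<close> keeps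
      \<open>c\<close> positive and makes the second factor negative.\<close>
    define c where "c = b + 1"
    have "c > 0" using \<open>b \<ge> 0\<close> by (simp add: c_def)
    have "0 \<le> 2 * (- (a / c)) * a + (- (a / c))\<^sup>2 * b"
      using pos unfolding a_def b_def by blast
    also have "\<dots> = (a / c)\<^sup>2 * (b - 2 * c)"
      using \<open>c > 0\<close> by (simp add: field_simps power2_eq_square)
    also have "\<dots> < 0"
      using \<open>a > 0\<close> \<open>b \<ge> 0\<close> \<open>c > 0\<close> by (intro mult_pos_neg) (auto simp: c_def)
    finally show False by simp
  qed
  then show ?thesis by (simp add: a_def)
qed

text \<open>The product of symmetric matrices need not be symmetric.  Writing the eigenvalue equation of
  \<open>L ** T\<close> as \<open>T *v v = l *\<^sub>R (matrix_inv L *v v)\<close> restores symmetry.\<close>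

lemma generalized_eigenvalues_finite:
  fixes A P :: "real^'n^'n"
  assumes A: "sym_mat A" and P: "sym_mat P" "pd_mat P"
  shows "finite {l. \<exists>v. v \<noteq> 0 \<and> A *v v = l *\<^sub>R (P *v v)}" (is "finite ?E")
proof -
  obtain e where e: "\<And>l. l \<in> ?E \<Longrightarrow> e l \<noteq> 0 \<and> A *v e l = l *\<^sub>R (P *v e l)"
  proof
    show "(SOME v. v \<noteq> 0 \<and> A *v v = l *\<^sub>R (P *v v)) \<noteq> 0 \<and>
        A *v (SOME v. v \<noteq> 0 \<and> A *v v = l *\<^sub>R (P *v v)) =
        l *\<^sub>R (P *v (SOME v. v \<noteq> 0 \<and> A *v v = l *\<^sub>R (P *v v)))" if "l \<in> ?E" for l
      using someI_ex[of "\<lambda>v. v \<noteq> 0 \<and> A *v v = l *\<^sub>R (P *v v)"] that by blast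
  qed
  \<comment> \<open>Eigenvectors chosen for different eigenvalues are orthogonal in the inner
    product of \<open>P\<close>. They therefore form an independent set, which is finite in finite
    dimension.\<close>
  have orth: "e k \<bullet> (P *v e l) = 0" if "k \<in> ?E" "l \<in> ?E" "k \<noteq> l" for k l
  proof -
    have "l * (e k \<bullet> (P *v e l)) = k * (e k \<bullet> (P *v e l))"
      using sym_mat_inner[OF A, of "e k" "e l"] sym_mat_inner[OF P(1), of "e k" "e l"] e that
      by auto
    then show ?thesis using that by simp
  qed
  have pos: "e k \<bullet> (P *v e k) > 0" if "k \<in> ?E" for k
    using P(2) e that by (auto simp: pd_mat_def)
  have inj: "inj_on e ?E"
  proof (rule inj_onI, rule ccontr)
    fix k l assume kl: "k \<in> ?E" "l \<in> ?E" "e k = e l" "k \<noteq> l"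
    then show False using orth[OF kl(1,2,4)] pos[OF kl(1)] by simp
  qed
  have "independent (e ` ?E)"
    unfolding dependent_explicit
  proof safe
    fix t u v
    assume t: "finite t" "t \<subseteq> e ` ?E" "(\<Sum>v\<in>t. u v *\<^sub>R v) = 0" "v \<in> t" "u v \<noteq> 0"
    obtain k where k: "k \<in> ?E" "v = e k" using t(2,4) by blast
    \<comment> \<open>Pairing the vanishing combination with \<open>P *v v\<close> isolates the
      coefficient of \<open>v\<close>.\<close>
    have "0 = (\<Sum>v\<in>t. u v *\<^sub>R v) \<bullet> (P *v v)" using t by simp
    also have "\<dots> = (\<Sum>y\<in>t. u y * (y \<bullet> (P *v v)))" by (simp add: inner_sum_left)
    also have "\<dots> = (\<Sum>y\<in>{v}. u y * (y \<bullet> (P *v v)))"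
    proof (rule sum.mono_neutral_right)
      show "\<forall>y\<in>t - {v}. u y * (y \<bullet> (P *v v)) = 0"
      proof
        fix y assume "y \<in> t - {v}"
        then obtain l where l: "l \<in> ?E" "y = e l" "y \<noteq> v" using t(2) by blast
        then show "u y * (y \<bullet> (P *v v)) = 0" using orth[OF l(1) k(1)] k(2) by auto
      qed
    qed (use t in auto)
    finally show False using pos[OF k(1)] k t by simp
  qed
  then have "finite (e ` ?E)" by (rule independent_imp_finite)
  then show ?thesis using inj by (rule finite_imageD)
qed

text \<open>The Rayleigh quotient attains its maximum \<open>l\<close> on the compact unit sphere.
  Then \<open>l *\<^sub>R P - A\<close> is positive semidefinite and its form vanishes at the
  maximizer, which thus lies in its kernel.\<close>

lemma generalized_Rayleigh_max:
  fixes A P :: "real^'n^'n"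
  assumes A: "sym_mat A" and P: "sym_mat P" "pd_mat P"
  obtains l v where "v \<noteq> 0" "A *v v = l *\<^sub>R (P *v v)" "\<And>u. u \<bullet> (A *v u) \<le> l * (u \<bullet> (P *v u))"
proof -
  let ?r = "\<lambda>u. (u \<bullet> (A *v u)) / (u \<bullet> (P *v u))"
  have "continuous_on (sphere 0 1) ?r"
  proof (intro continuous_intros matrix_vector_mult_linear_continuous_on ballI)
    show "u \<bullet> (P *v u) \<noteq> 0" if "u \<in> sphere 0 1" for u
      using P(2) that unfolding pd_mat_def
      by (metis dist_self less_irrefl mem_sphere zero_neq_one)
  qed
  moreover have "axis i 1 \<in> sphere (0::real^'n) 1" for i
    by simp
  then have "sphere (0::real^'n) 1 \<noteq> {}" by blast
  ultimately have "\<exists>v\<in>sphere 0 1. \<forall>u\<in>sphere 0 1. ?r u \<le> ?r v"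
    by (intro continuous_attains_sup compact_sphere)
  then obtain v where v: "v \<in> sphere 0 1" "\<And>u. u \<in> sphere 0 1 \<Longrightarrow> ?r u \<le> ?r v"
    by blast
  have v0: "v \<noteq> 0" using v(1) by auto
  define l where "l = ?r v"
  have bound: "u \<bullet> (A *v u) \<le> l * (u \<bullet> (P *v u))" for u
  proof (cases "u = 0")
    case False
    let ?w = "(1 / norm u) *\<^sub>R u"
    have "?r ?w \<le> l" unfolding l_def using v False by (intro v) auto
    moreover have "u \<bullet> (P *v u) > 0" using P(2) False by (simp add: pd_mat_def)
    ultimately show ?thesis
      using False by (simp add: matrix_vector_mult_scaleR field_simps)
  qed simp
  define N where "N = l *\<^sub>R P - A"
  have N: "N *v u = l *\<^sub>R (P *v u) - A *v u" for u
    unfolding N_def by (simp add: matrix_vector_mult_diff_rdistrib scaleR_matrix_vector_assoc)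
  have "sym_mat N"
    using A P unfolding sym_mat_def N_def by (simp add: transpose_def vec_eq_iff)
  moreover have "psd_mat N"
    using bound by (simp add: psd_mat_def N inner_diff_right)
  moreover have "v \<bullet> (N *v v) = 0"
    using P(2) v0 by (force simp: N inner_diff_right l_def pd_mat_def)
  ultimately have "N *v v = 0" by (rule psd_form_zero_imp_kernel)
  then show ?thesis using that[OF v0 _ bound] by (simp add: N)
qed

text \<open>The last assumption identifies the eigenvalues of \<open>K\<close>, possibly not
  symmetric, with those of the symmetric pair \<open>A\<close>, \<open>P\<close>. These are finitely
  many and include the maximal Rayleigh quotient, so \<open>Max\<close> is a genuine maximum that
  dominates it.\<close>

lemma inner_le_lambda_max:
  fixes K A P :: "real^'n^'n"
  assumes A: "sym_mat A" and P: "sym_mat P" "pd_mat P"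
    and K: "\<And>l v. K *v v = l *\<^sub>R v \<longleftrightarrow> A *v v = l *\<^sub>R (P *v v)"
  shows "u \<bullet> (A *v u) \<le> lambda_max K * (u \<bullet> (P *v u))"
proof -
  obtain l v where l: "v \<noteq> 0" "A *v v = l *\<^sub>R (P *v v)"
      "\<And>u. u \<bullet> (A *v u) \<le> l * (u \<bullet> (P *v u))"
    using generalized_Rayleigh_max[OF A P] by metis
  have "l \<in> eigenvals K" "finite (eigenvals K)"
    using l generalized_eigenvalues_finite[OF A P] by (auto simp: eigenvals_def K)
  then have "l \<le> lambda_max K" by (simp add: lambda_max_def)
  moreover have "0 \<le> u \<bullet> (P *v u)"
    using P(2) unfolding pd_mat_def by (cases "u = 0") (auto intro: less_imp_le)
  ultimately have "l * (u \<bullet> (P *v u)) \<le> lambda_max K * (u \<bullet> (P *v u))"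
    by (rule mult_right_mono)
  then show ?thesis using l(3)[of u] by linarith
qed

text \<open>The Rayleigh maximum of \<open>- A\<close> against the identity is, up to sign, an
  eigenvalue of \<open>A\<close>; hence \<open>Min\<close> ranges over a finite nonempty
  set.\<close>

lemma lambda_min_symmetric:
  fixes A :: "real^'n^'n"
  assumes "sym_mat A"
  shows "lambda_min A \<in> eigenvals A"
    and "lambda_min A * (u \<bullet> u) \<le> u \<bullet> (A *v u)"
proof -
  have I: "sym_mat (mat 1 :: real^'n^'n)" "pd_mat (mat 1 :: real^'n^'n)"
    by (auto simp: sym_mat_def pd_mat_def)
  have neg: "sym_mat (- A)"
    using assms by (simp add: sym_mat_def transpose_def vec_eq_iff)
  have mv: "(- A) *v v = - (A *v v)" for v
    by (simp add: vec_eq_iff matrix_vector_mult_def sum_negf)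
  have fin: "finite (eigenvals A)"
    using generalized_eigenvalues_finite[OF assms I] by (simp add: eigenvals_def)
  obtain l v where l: "v \<noteq> 0" "(- A) *v v = l *\<^sub>R (mat 1 *v v)"
      "\<And>u. u \<bullet> ((- A) *v u) \<le> l * (u \<bullet> (mat 1 *v u))"
    using generalized_Rayleigh_max[OF neg I] by metis
  have "A *v v = (- l) *\<^sub>R v" using l(2) by (simp add: mv) (metis minus_minus)
  then have mem: "- l \<in> eigenvals A" using l(1) by (auto simp: eigenvals_def)
  then show "lambda_min A \<in> eigenvals A"
    unfolding lambda_min_def using fin by (intro Min_in) auto
  have "lambda_min A \<le> - l" unfolding lambda_min_def using fin mem by simp
  then have "lambda_min A * (u \<bullet> u) \<le> - l * (u \<bullet> u)" by (intro mult_right_mono) auto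
  also have "\<dots> \<le> u \<bullet> (A *v u)" using l(3)[of u] by (simp add: mv)
  finally show "lambda_min A * (u \<bullet> u) \<le> u \<bullet> (A *v u)" .
qed

section \<open>Inverses of positive definite matrices\<close>

lemma pd_mat_imp_invertible:
  fixes A :: "real^'n^'n"
  assumes "pd_mat A"
  shows "invertible A"
proof -
  have "\<forall>x. A *v x = 0 \<longrightarrow> x = 0"
    using assms unfolding pd_mat_def by (metis inner_zero_right less_irrefl)
  then show ?thesis
    by (simp add: invertible_left_inverse matrix_left_invertible_ker)
qed

lemma pd_mat_inverse:
  fixes A :: "real^'n^'n"
  assumes "sym_mat A" "pd_mat A"
  shows "A *v (matrix_inv A *v x) = x" "matrix_inv A *v (A *v x) = x"
    and "sym_mat (matrix_inv A)" "pd_mat (matrix_inv A)"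
proof -
  have inv: "A ** matrix_inv A = mat 1" "matrix_inv A ** A = mat 1"
    using someI_ex[OF pd_mat_imp_invertible[OF assms(2), unfolded invertible_def]]
    unfolding matrix_inv_def by simp_all
  show 1: "A *v (matrix_inv A *v x) = x" for x
    by (simp add: matrix_vector_mul_assoc inv)
  show 2: "matrix_inv A *v (A *v x) = x" for x
    by (simp add: matrix_vector_mul_assoc inv)
  show "sym_mat (matrix_inv A)"
  proof -
    have "transpose (matrix_inv A) ** A = mat 1"
      using inv(1) assms(1) unfolding sym_mat_def by (metis matrix_transpose_mul transpose_mat)
    then have "transpose (matrix_inv A) ** (A ** matrix_inv A) = matrix_inv A"
      by (simp add: matrix_mul_assoc)
    then show ?thesis by (simp add: inv sym_mat_def)
  qed
  show "pd_mat (matrix_inv A)"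
    unfolding pd_mat_def
  proof safe
    fix v :: "real^'n" assume "v \<noteq> 0"
    then have "matrix_inv A *v v \<noteq> 0" using 1[of v] by auto
    then have "0 < (matrix_inv A *v v) \<bullet> (A *v (matrix_inv A *v v))"
      using assms(2) by (simp add: pd_mat_def)
    then show "0 < v \<bullet> (matrix_inv A *v v)" by (simp add: 1 inner_commute)
  qed
qed

subsection \<open>Proximal maps\<close>

text \<open>On the way from \<open>u\<close> to \<open>v\<close>, minimality and convexity of
  \<open>\<psi>\<close> keep the difference quotient of \<open>F\<close> above
  \<open>\<psi> u - \<psi> v\<close>; the limit at 0 from the right gives the claim. It serves both
  the proximal objective and the sum of \<open>f\<close> and \<open>\<psi>\<close>.\<close>

lemma minimizer_subgradient:
  fixes F :: "real^'n \<Rightarrow> real" and \<psi> :: "real^'n \<Rightarrow> ereal"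
  assumes F: "GDERIV F u :> d"
    and proper: "\<And>x. \<psi> x \<noteq> -\<infinity>" "\<exists>x. \<psi> x \<noteq> \<infinity>"
    and convex: "convex (ext_epigraph \<psi>)"
    and min: "\<And>v. ereal (F u) + \<psi> u \<le> ereal (F v) + \<psi> v"
  shows "\<psi> u \<noteq> \<infinity>" and "\<psi> u \<le> \<psi> v + ereal (d \<bullet> (v - u))"
proof -
  obtain z where "\<psi> z \<noteq> \<infinity>" using proper(2) by blast
  with min[of z] show fin: "\<psi> u \<noteq> \<infinity>" by (cases "\<psi> u"; cases "\<psi> z") auto
  show "\<psi> u \<le> \<psi> v + ereal (d \<bullet> (v - u))"
  proof (cases "\<psi> v = \<infinity>")
    case False
    obtain r s where rs: "\<psi> u = ereal r" "\<psi> v = ereal s"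
      using fin False proper(1)[of u] proper(1)[of v] by (cases "\<psi> u"; cases "\<psi> v") auto
    let ?l = "\<lambda>t. u + t *\<^sub>R (v - u)"
    have "(F has_derivative (\<lambda>h. h \<bullet> d)) (at (?l 0))"
      using F by (simp add: gderiv_def)
    then have "((\<lambda>t. F (?l t)) has_derivative (\<lambda>t. (t *\<^sub>R (v - u)) \<bullet> d)) (at 0)"
      by (rule has_derivative_compose[rotated]) (auto intro!: derivative_eq_intros)
    then have "((\<lambda>t. F (?l t)) has_real_derivative (d \<bullet> (v - u))) (at 0)"
      by (simp add: has_field_derivative_def inner_commute mult_commute_abs)
    then have "((\<lambda>t. (F (?l t) - F u) / t) \<longlongrightarrow> d \<bullet> (v - u)) (at 0)"
      by (simp add: has_field_derivative_iff)
    then have lim: "((\<lambda>t. (F (?l t) - F u) / t) \<longlongrightarrow> d \<bullet> (v - u)) (at_right 0)"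
      by (rule tendsto_mono[rotated]) (simp add: at_le)
    have "r - s \<le> (F (?l t) - F u) / t" if t: "0 < t" "t < 1" for t
    proof -
      have "(1 - t) *\<^sub>R (u, r) + t *\<^sub>R (v, s) \<in> ext_epigraph \<psi>"
        by (rule convexD[OF convex]) (use t rs in \<open>auto simp: ext_epigraph_def\<close>)
      also have "(1 - t) *\<^sub>R (u, r) + t *\<^sub>R (v, s) = (?l t, (1 - t) * r + t * s)"
        by (simp add: algebra_simps)
      finally have "\<psi> (?l t) \<le> ereal ((1 - t) * r + t * s)"
        by (simp add: ext_epigraph_def)
      then have "ereal (F u + r) \<le> ereal (F (?l t) + ((1 - t) * r + t * s))"
        using min[of "?l t"] rs by (cases "\<psi> (?l t)") auto
      then show ?thesis using t by (simp add: field_simps)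
    qed
    then have "\<forall>\<^sub>F t in at_right 0. r - s \<le> (F (?l t) - F u) / t"
      unfolding eventually_at_right_field by (intro exI[of _ 1]) auto
    from tendsto_lowerbound[OF lim this] show ?thesis by (simp add: rs)
  qed simp
qed

section \<open>Proximal points under an affine minorant\<close>

context
  fixes \<psi> :: "real^'n \<Rightarrow> ereal" and c \<tau> :: real and a :: "real^'n"
  assumes pcc: "proper_closed_convex \<psi>"
    and minorant: "\<And>u. ereal (c + a \<bullet> u) \<le> \<psi> u"
    and \<tau>: "\<tau> > 0"
begin

text \<open>Minimizing over pairs \<open>(u, r)\<close> of the epigraph replaces the extended-valued
  objective by the continuous \<open>F\<close>. The quadratic term outgrows the affine minorant, so
  the sublevel set \<open>K\<close> is bounded, and closedness of the epigraph makes it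
  compact.\<close>

lemma prox_minimizer_exists:
  "\<exists>u. \<forall>v. ereal \<tau> * \<psi> u + ereal (1 / 2 * (norm (u - x))\<^sup>2) \<le> ereal \<tau> * \<psi> v + ereal (1 / 2 * (norm (v - x))\<^sup>2)"
proof -
  define F where "F = (\<lambda>(u, r). \<tau> * r + 1 / 2 * (norm (u - x))\<^sup>2)"
  have F_cont: "continuous_on UNIV F"
    unfolding F_def split_def by (intro continuous_intros)
  obtain z r0 where z: "\<psi> z = ereal r0"
    using pcc unfolding proper_closed_convex_def by (metis ereal_cases)
  define K where "K = ext_epigraph \<psi> \<inter> {y. F y \<le> F (z, r0)}"
  \<comment> \<open>\<open>k\<close> is the level less \<open>\<tau>\<close> times the minorant at
    \<open>x\<close>: a point of \<open>K\<close> at distance \<open>n\<close> from \<open>x\<close>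
    satisfies \<open>n\<^sup>2 / 2 - \<tau> * norm a * n \<le> k\<close>, and \<open>N\<close> is
    chosen so that this fails for \<open>n > N\<close>.\<close>
  define k where "k = F (z, r0) - \<tau> * (c + a \<bullet> x)"
  define N where "N = 2 * \<bar>k\<bar> + 2 * \<tau> * norm a + 1"
  have "K \<subseteq> cball x N \<times> {c + a \<bullet> x - norm a * N .. F (z, r0) / \<tau>}"
  proof clarify
    fix u r assume "(u, r) \<in> K"
    then have K: "\<psi> u \<le> ereal r" "\<tau> * r + 1 / 2 * (norm (u - x))\<^sup>2 \<le> F (z, r0)"
      by (auto simp: K_def ext_epigraph_def F_def)
    let ?n = "norm (u - x)"
    have "c + a \<bullet> u \<le> r" using order_trans[OF minorant K(1)] by simp
    moreover have "- norm a * ?n \<le> a \<bullet> (u - x)"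
      using Cauchy_Schwarz_ineq2[of a "u - x"] by linarith
    ultimately have r: "c + a \<bullet> x - norm a * ?n \<le> r" by (simp add: inner_diff_right)
    then have "\<tau> * (c + a \<bullet> x - norm a * ?n) \<le> \<tau> * r" using \<tau> by simp
    then have n: "1 / 2 * ?n\<^sup>2 - \<tau> * norm a * ?n \<le> k"
      using K(2) by (simp add: k_def algebra_simps)
    have nN: "?n \<le> N"
    proof (rule ccontr)
      assume "\<not> ?n \<le> N"
      then have *: "?n > 2 * \<bar>k\<bar> + 2 * \<tau> * norm a + 1" by (simp add: N_def)
      have "0 \<le> \<tau> * norm a" using \<tau> by simp
      with * have "?n > 1" "?n - 2 * (\<tau> * norm a) > 2 * \<bar>k\<bar> + 1" by linarith+
      then have "1 * (2 * \<bar>k\<bar> + 1) \<le> ?n * (?n - 2 * (\<tau> * norm a))"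
        by (intro mult_mono) auto
      with n show False by (simp add: power2_eq_square algebra_simps)
    qed
    have "norm a * ?n \<le> norm a * N" using nN by (simp add: mult_left_mono)
    with r have "c + a \<bullet> x - norm a * N \<le> r" by linarith
    moreover have "\<tau> * r \<le> F (z, r0)" using K(2) zero_le_power2[of ?n] by linarith
    then have "r \<le> F (z, r0) / \<tau>" using \<tau> by (simp add: field_simps)
    ultimately show "u \<in> cball x N \<and> r \<in> {c + a \<bullet> x - norm a * N .. F (z, r0) / \<tau>}"
      using nN by (simp add: dist_norm norm_minus_commute)
  qed
  moreover have "closed K"
    using pcc F_cont unfolding K_def proper_closed_convex_def
    by (intro closed_Int closed_Collect_le) auto
  ultimately have "compact K"
    by (metis compact_Times compact_cball compact_Icc compact_Int_closed inf.absorb2)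
  moreover have zK: "(z, r0) \<in> K" by (simp add: K_def ext_epigraph_def z)
  ultimately obtain u r where ur: "(u, r) \<in> K" "\<And>y. y \<in> K \<Longrightarrow> F (u, r) \<le> F y"
    using continuous_attains_inf[of K F] continuous_on_subset[OF F_cont subset_UNIV]
    by (metis empty_iff surj_pair)
  \<comment> \<open>A pair of the epigraph left out of \<open>K\<close> has a larger
    \<open>F\<close> than \<open>(z, r0)\<close>, so the minimum over \<open>K\<close> is
    global.\<close>
  have minF: "F (u, r) \<le> F (v, s)" if "\<psi> v = ereal s" for v s
    using ur zK that by (cases "(v, s) \<in> K") (fastforce simp: K_def ext_epigraph_def)+
  have "ereal \<tau> * \<psi> u + ereal (1 / 2 * (norm (u - x))\<^sup>2) \<le> ereal (F (u, r))"
  proof -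
    have "\<psi> u \<le> ereal r" using ur(1) by (simp add: K_def ext_epigraph_def)
    moreover have "\<psi> u \<noteq> -\<infinity>" using pcc by (simp add: proper_closed_convex_def)
    ultimately show ?thesis using \<tau> by (cases "\<psi> u") (auto simp: F_def)
  qed
  moreover have "ereal (F (u, r)) \<le> ereal \<tau> * \<psi> v + ereal (1 / 2 * (norm (v - x))\<^sup>2)" for v
  proof (cases "\<psi> v")
    case (real s)
    then show ?thesis using minF[OF real] by (simp add: F_def)
  next
    case MInf
    then show ?thesis using pcc by (simp add: proper_closed_convex_def)
  qed (use \<tau> in simp)
  ultimately show ?thesis using order_trans by blast
qed

text \<open>\<open>prox\<close> is a choice through \<open>arg_min\<close>, so its defining property
  becomes available only once a minimizer exists.\<close>

lemma prox_minimizes: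
  fixes x :: "real^'n"
  defines "u \<equiv> prox (\<lambda>u. ereal \<tau> * \<psi> u) x"
  shows "ereal \<tau> * \<psi> u + ereal (1 / 2 * (norm (u - x))\<^sup>2) \<le> ereal \<tau> * \<psi> v + ereal (1 / 2 * (norm (v - x))\<^sup>2)"
proof -
  let ?f = "\<lambda>u. ereal \<tau> * \<psi> u + ereal (1 / 2 * (norm (u - x))\<^sup>2)"
  have "\<exists>u. is_arg_min ?f (\<lambda>_. True) u"
    using prox_minimizer_exists[of x] by (simp add: is_arg_min_linorder)
  then have "is_arg_min ?f (\<lambda>_. True) u"
    unfolding u_def prox_def arg_min_def by (rule someI_ex)
  then show ?thesis by (simp add: is_arg_min_linorder)
qed

text \<open>Dividing the objective by \<open>\<tau>\<close> gives \<open>\<psi>\<close> weight one;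
  the quadratic then has gradient \<open>(1 / \<tau>) *\<^sub>R (u - x)\<close> at the
  minimizer.\<close>

lemma prox_subgradient:
  fixes x :: "real^'n"
  defines "u \<equiv> prox (\<lambda>u. ereal \<tau> * \<psi> u) x"
  shows "\<psi> u \<noteq> \<infinity>" and "\<psi> u \<le> \<psi> v + ereal (((u - x) \<bullet> (v - u)) / \<tau>)"
proof -
  have fin: "\<psi> v \<noteq> -\<infinity>" for v using pcc by (simp add: proper_closed_convex_def)
  have min: "ereal (1 / (2 * \<tau>) * (norm (u - x))\<^sup>2) + \<psi> u \<le> ereal (1 / (2 * \<tau>) * (norm (v - x))\<^sup>2) + \<psi> v" for v
  proof -
    have "1 / (2 * \<tau>) * m + r \<le> 1 / (2 * \<tau>) * n + s" if "\<tau> * r + 1 / 2 * m \<le> \<tau> * s + 1 / 2 * n"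
      for r s m n :: real
      using divide_right_mono[OF that, of \<tau>] \<tau> by (simp add: add_divide_distrib)
    from this[of _ "(norm (u - x))\<^sup>2" _ "(norm (v - x))\<^sup>2"] show ?thesis
      using prox_minimizes[of x v, folded u_def] fin[of u] fin[of v] \<tau>
      by (cases "\<psi> u"; cases "\<psi> v") auto
  qed
  have "((\<lambda>u. 1 / (2 * \<tau>) * ((u - x) \<bullet> (u - x))) has_derivative (\<lambda>h. h \<bullet> ((1 / \<tau>) *\<^sub>R (u - x)))) (at u)"
    using \<tau> by (auto intro!: derivative_eq_intros simp: fun_eq_iff inner_commute inner_diff_right field_simps)
  then have D: "GDERIV (\<lambda>u. 1 / (2 * \<tau>) * (norm (u - x))\<^sup>2) u :> (1 / \<tau>) *\<^sub>R (u - x)"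
    by (simp add: gderiv_def power2_norm_eq_inner)
  have cvx: "\<exists>x. \<psi> x \<noteq> \<infinity>" "convex (ext_epigraph \<psi>)"
    using pcc by (auto simp: proper_closed_convex_def)
  show "\<psi> u \<noteq> \<infinity>" "\<psi> u \<le> \<psi> v + ereal (((u - x) \<bullet> (v - u)) / \<tau>)"
    using minimizer_subgradient[OF D fin cvx min] by simp_all
qed

text \<open>Each proximal point is tested in the subgradient inequality of the other; in the sum the
  values of \<open>\<psi>\<close> cancel and Cauchy-Schwarz finishes. The Lipschitz continuity
  obtained here makes the map measurable.\<close>

lemma prox_nonexpansive:
  "norm (prox (\<lambda>u. ereal \<tau> * \<psi> u) x - prox (\<lambda>u. ereal \<tau> * \<psi> u) y) \<le> norm (x - y)"
proof -
  let ?p = "\<lambda>x. prox (\<lambda>u. ereal \<tau> * \<psi> u) x"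
  have fin: "\<psi> v \<noteq> -\<infinity>" for v using pcc by (simp add: proper_closed_convex_def)
  obtain r s where rs: "\<psi> (?p x) = ereal r" "\<psi> (?p y) = ereal s"
    using prox_subgradient(1) fin by (metis ereal_cases)
  have "r \<le> s + ((?p x - x) \<bullet> (?p y - ?p x)) / \<tau>" "s \<le> r + ((?p y - y) \<bullet> (?p x - ?p y)) / \<tau>"
    using prox_subgradient(2)[of x "?p y"] prox_subgradient(2)[of y "?p x"] rs by auto
  then have "0 \<le> ((?p x - x) \<bullet> (?p y - ?p x)) / \<tau> + ((?p y - y) \<bullet> (?p x - ?p y)) / \<tau>"
    by linarith
  then have "0 \<le> (?p x - x) \<bullet> (?p y - ?p x) + (?p y - y) \<bullet> (?p x - ?p y)"
    using \<tau> by (simp add: add_divide_distrib[symmetric] zero_le_divide_iff)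
  then have "(?p x - ?p y) \<bullet> (?p x - ?p y) \<le> (x - y) \<bullet> (?p x - ?p y)"
    by (simp add: inner_diff_left inner_diff_right inner_commute)
  also have "\<dots> \<le> norm (x - y) * norm (?p x - ?p y)" by (rule norm_cauchy_schwarz)
  finally have "norm (?p x - ?p y) * norm (?p x - ?p y) \<le> norm (x - y) * norm (?p x - ?p y)"
    by (simp add: power2_norm_eq_inner[symmetric] power2_eq_square)
  then show ?thesis
    by (cases "norm (?p x - ?p y) = 0") (auto simp: mult_le_cancel_right)
qed

lemma prox_measurable: "prox (\<lambda>u. ereal \<tau> * \<psi> u) \<in> borel_measurable borel"
proof -
  have "1-lipschitz_on UNIV (prox (\<lambda>u. ereal \<tau> * \<psi> u))"
    by (rule lipschitz_onI) (use prox_nonexpansive in \<open>simp_all add: dist_norm\<close>)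
  then show ?thesis
    by (intro borel_measurable_continuous_onI lipschitz_on_continuous_on)
qed

end

text \<open>Optimality of \<open>xs\<close> yields the affine minorant of \<open>\<psi>\<close> that makes the proximal problem
  coercive, and says \<open>xs = prox (xs - \<tau> hs)\<close>.\<close>

lemma prox_firmly_nonexpansive_at_minimizer:
  fixes f :: "real^'n \<Rightarrow> real" and \<psi> :: "real^'n \<Rightarrow> ereal"
  assumes pcc: "proper_closed_convex \<psi>" and \<tau>: "\<tau> > 0"
    and D: "GDERIV f xs :> hs"
    and min: "is_arg_min (\<lambda>y. ereal (f y) + \<psi> y) (\<lambda>_. True) xs"
  shows "(prox (\<lambda>u. ereal \<tau> * \<psi> u) p - xs) \<bullet> (prox (\<lambda>u. ereal \<tau> * \<psi> u) p - xs)
      \<le> (p - (xs - \<tau> *\<^sub>R hs)) \<bullet> (prox (\<lambda>u. ereal \<tau> * \<psi> u) p - xs)" (is ?firm)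
    and "prox (\<lambda>u. ereal \<tau> * \<psi> u) \<in> borel_measurable borel"
proof -
  have p: "\<And>x. \<psi> x \<noteq> -\<infinity>" "\<exists>x. \<psi> x \<noteq> \<infinity>" "convex (ext_epigraph \<psi>)"
    using pcc by (auto simp: proper_closed_convex_def)
  have m: "ereal (f xs) + \<psi> xs \<le> ereal (f v) + \<psi> v" for v
    using min by (simp add: is_arg_min_linorder)
  note sub = minimizer_subgradient[OF D p m]
  obtain r where r: "\<psi> xs = ereal r" using sub(1) p(1) by (metis ereal_cases)
  have minorant: "ereal ((r + hs \<bullet> xs) + (- hs) \<bullet> u) \<le> \<psi> u" for u
    using sub(2)[of u] p(1)[of u] r by (cases "\<psi> u") (auto simp: inner_diff_right)
  show "prox (\<lambda>u. ereal \<tau> * \<psi> u) \<in> borel_measurable borel"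
    by (rule prox_measurable[OF pcc minorant \<tau>])
  let ?u = "prox (\<lambda>u. ereal \<tau> * \<psi> u) p"
  obtain s where s: "\<psi> ?u = ereal s"
    using prox_subgradient(1)[OF pcc minorant \<tau>] p(1) by (metis ereal_cases)
  \<comment> \<open>Optimality of \<open>?u\<close> is tested at \<open>xs\<close> and that of
    \<open>xs\<close> at \<open>?u\<close>; adding the two cancels \<open>r\<close> and
    \<open>s\<close>.\<close>
  have "s \<le> r + ((?u - p) \<bullet> (xs - ?u)) / \<tau>" "r \<le> s + hs \<bullet> (?u - xs)"
    using prox_subgradient(2)[OF pcc minorant \<tau>, of p xs] sub(2)[of ?u] r s by auto
  then have "0 \<le> ((?u - p) \<bullet> (xs - ?u)) / \<tau> + hs \<bullet> (?u - xs)" by linarith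
  then have "0 \<le> (?u - p) \<bullet> (xs - ?u) + \<tau> * (hs \<bullet> (?u - xs))"
    using \<tau> by (simp add: field_simps)
  then show ?firm
    by (simp add: inner_diff_left inner_diff_right inner_commute algebra_simps)
qed

subsection \<open>Second moments of compressors\<close>

text \<open>In the expanded square the cross term is linear in \<open>c\<close>, so its mean is
  known exactly and only the quadratic term is estimated. Finiteness of the \<open>ennreal\<close>
  moment supplies integrability.\<close>

lemma second_moment_deviation:
  fixes c :: "'s \<Rightarrow> real^'n"
  assumes S: "prob_space S" and c: "integrable S c" "(\<integral>s. c s \<partial>S) = u"
    and sq: "(\<integral>\<^sup>+s. ennreal ((norm (c s))\<^sup>2) \<partial>S) \<le> ennreal v" and v: "0 \<le> v"
  shows "integrable S (\<lambda>s. (norm (a - k *\<^sub>R c s))\<^sup>2)"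
    and "(\<integral>s. (norm (a - k *\<^sub>R c s))\<^sup>2 \<partial>S) \<le> (norm a)\<^sup>2 - 2 * k * (a \<bullet> u) + k\<^sup>2 * v"
proof -
  interpret prob_space S by fact
  have [measurable]: "c \<in> borel_measurable S" using c(1) by simp
  have int: "integrable S (\<lambda>s. (norm (c s))\<^sup>2)"
    using sq by (intro integrableI_nonneg) (auto intro: le_less_trans)
  have eq: "(norm (a - k *\<^sub>R c s))\<^sup>2 = (norm a)\<^sup>2 - 2 * k * (a \<bullet> c s) + k\<^sup>2 * (norm (c s))\<^sup>2" for s
    unfolding power2_norm_eq_inner
    by (simp add: inner_diff_left inner_diff_right inner_commute algebra_simps power2_eq_square)
  show "integrable S (\<lambda>s. (norm (a - k *\<^sub>R c s))\<^sup>2)"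
    unfolding eq using int c(1) by auto
  have "ennreal (\<integral>s. (norm (c s))\<^sup>2 \<partial>S) \<le> ennreal v"
    using sq int by (subst nn_integral_eq_integral[symmetric]) auto
  then have le: "(\<integral>s. (norm (c s))\<^sup>2 \<partial>S) \<le> v" using v by simp
  have "(\<integral>s. (norm (a - k *\<^sub>R c s))\<^sup>2 \<partial>S) =
      (norm a)\<^sup>2 - 2 * k * (a \<bullet> u) + k\<^sup>2 * (\<integral>s. (norm (c s))\<^sup>2 \<partial>S)"
    unfolding eq using int c by (simp add: prob_space)
  then show "(\<integral>s. (norm (a - k *\<^sub>R c s))\<^sup>2 \<partial>S) \<le> (norm a)\<^sup>2 - 2 * k * (a \<bullet> u) + k\<^sup>2 * v"
    using le by (simp add: mult_left_mono)
qed

text \<open>Here \<open>a\<close> and \<open>e\<close> are the deviations of \<open>xhat\<close> and \<open>hhat\<close> from \<open>xs\<close> and \<open>hs\<close>, and \<open>q\<close> is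
  that of the proximal point, so that \<open>a - q\<close> is the argument of the compressor.\<close>

lemma scalar_compressor_contraction:
  fixes Cs :: "'r \<Rightarrow> real^'n \<Rightarrow> real^'n" and a e q :: "real^'n"
  assumes Cs: "scalar_compressor \<omega> R Cs" and \<omega>: "0 \<le> \<omega>"
    and firm: "q \<bullet> q \<le> (a - (\<gamma> * (1 + \<omega>)) *\<^sub>R e) \<bullet> q"
  shows "(\<integral>\<^sup>+r. ennreal ((norm (a - (1 / (1 + \<omega>)) *\<^sub>R Cs r (a - q)))\<^sup>2 +
              (norm ((\<gamma> * (1 + \<omega>)) *\<^sub>R e - (1 / (1 + \<omega>)) *\<^sub>R Cs r (a - q)))\<^sup>2) \<partial>R)
      \<le> ennreal ((norm (a - \<gamma> *\<^sub>R e))\<^sup>2 + \<gamma>\<^sup>2 * (\<omega> * (\<omega> + 2)) * (norm e)\<^sup>2)"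
proof -
  let ?u = "a - q" and ?b = "(\<gamma> * (1 + \<omega>)) *\<^sub>R e" and ?k = "1 / (1 + \<omega>)"
  note c = Cs[unfolded scalar_compressor_def randomized_operator_def unbiased_operator_def]
  note dev = second_moment_deviation[where c = "\<lambda>r. Cs r ?u" and S = R and k = ?k
      and v = "(1 + \<omega>) * (norm ?u)\<^sup>2" and u = ?u]
  have dev1: "integrable R (\<lambda>r. (norm (y - ?k *\<^sub>R Cs r ?u))\<^sup>2)"
    and dev2: "(\<integral>r. (norm (y - ?k *\<^sub>R Cs r ?u))\<^sup>2 \<partial>R)
      \<le> (norm y)\<^sup>2 - 2 * ?k * (y \<bullet> ?u) + ?k\<^sup>2 * ((1 + \<omega>) * (norm ?u)\<^sup>2)" for y
    using dev[of y] c \<omega> by auto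
  \<comment> \<open>Of the two damping factors in \<open>?k\<^sup>2\<close>, one absorbs the
    variance factor \<open>1 + \<omega>\<close>.\<close>
  have kk: "?k\<^sup>2 * ((1 + \<omega>) * (norm ?u)\<^sup>2) = ?k * (norm ?u)\<^sup>2"
    using \<omega> by (simp add: power2_eq_square)
  have "(\<integral>r. (norm (a - ?k *\<^sub>R Cs r ?u))\<^sup>2 + (norm (?b - ?k *\<^sub>R Cs r ?u))\<^sup>2 \<partial>R)
      \<le> (norm a)\<^sup>2 + (norm ?b)\<^sup>2 - 2 * ?k * ((a + ?b) \<bullet> ?u - (norm ?u)\<^sup>2)"
    using dev2[of a] dev2[of ?b] dev1[of a] dev1[of ?b] unfolding kk
    by (simp add: inner_add_left algebra_simps add_divide_distrib diff_divide_distrib)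
  also have "\<dots> \<le> (norm a)\<^sup>2 + (norm ?b)\<^sup>2 - 2 * ?k * (a \<bullet> ?b)"
  proof -
    \<comment> \<open>With \<open>?u = a - q\<close>, the excess over \<open>a \<bullet> ?b\<close>
      is exactly the slack in \<open>firm\<close>.\<close>
    have "(a + ?b) \<bullet> ?u - (norm ?u)\<^sup>2 = a \<bullet> ?b + ((a - ?b) \<bullet> q - q \<bullet> q)"
      by (simp add: power2_norm_eq_inner inner_diff_left inner_diff_right inner_add_left
          inner_add_right inner_commute algebra_simps)
    then have "a \<bullet> ?b \<le> (a + ?b) \<bullet> ?u - (norm ?u)\<^sup>2" using firm by simp
    then have "2 * ?k * (a \<bullet> ?b) \<le> 2 * ?k * ((a + ?b) \<bullet> ?u - (norm ?u)\<^sup>2)"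
      using \<omega> by (intro mult_left_mono) auto
    then show ?thesis by linarith
  qed
  also have "\<dots> = (norm (a - \<gamma> *\<^sub>R e))\<^sup>2 + \<gamma>\<^sup>2 * (\<omega> * (\<omega> + 2)) * (norm e)\<^sup>2"
  proof -
    have 1: "2 * ?k * (a \<bullet> ?b) = 2 * \<gamma> * (a \<bullet> e)" using \<omega> by simp
    have 2: "(norm ?b)\<^sup>2 = (\<gamma> * (1 + \<omega>))\<^sup>2 * (norm e)\<^sup>2" by (simp add: power_mult_distrib)
    have 3: "(norm (a - \<gamma> *\<^sub>R e))\<^sup>2 = (norm a)\<^sup>2 - 2 * \<gamma> * (a \<bullet> e) + \<gamma>\<^sup>2 * (norm e)\<^sup>2"
      unfolding power2_norm_eq_inner
      by (simp add: inner_diff_left inner_diff_right inner_commute algebra_simps power2_eq_square)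
    \<comment> \<open>Since \<open>(1 + \<omega>)\<^sup>2 = 1 + \<omega> * (\<omega> + 2)\<close>,
      one copy of \<open>\<gamma>\<^sup>2 * (norm e)\<^sup>2\<close> completes the square and the
      rest is the surplus.\<close>
    show ?thesis unfolding 1 2 3 by (simp add: power2_eq_square algebra_simps)
  qed
  finally have "(\<integral>r. (norm (a - ?k *\<^sub>R Cs r ?u))\<^sup>2 + (norm (?b - ?k *\<^sub>R Cs r ?u))\<^sup>2 \<partial>R)
      \<le> (norm (a - \<gamma> *\<^sub>R e))\<^sup>2 + \<gamma>\<^sup>2 * (\<omega> * (\<omega> + 2)) * (norm e)\<^sup>2" .
  moreover have "(\<integral>\<^sup>+r. ennreal ((norm (a - ?k *\<^sub>R Cs r ?u))\<^sup>2 + (norm (?b - ?k *\<^sub>R Cs r ?u))\<^sup>2) \<partial>R) =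
      ennreal (\<integral>r. (norm (a - ?k *\<^sub>R Cs r ?u))\<^sup>2 + (norm (?b - ?k *\<^sub>R Cs r ?u))\<^sup>2 \<partial>R)"
    using dev1 by (intro nn_integral_eq_integral) auto
  ultimately show ?thesis by (simp only: ennreal_leI)
qed

text \<open>The identity \<open>(mat 1 + \<Omega>) *v (Q *v x) = x\<close> turns forms of
  \<open>\<Omega>\<close> at \<open>Q *v x\<close> into forms of \<open>Q\<close>. For the last
  bound, the eigenvalue estimate at \<open>Q *v x\<close> and Cauchy-Schwarz give
  \<open>norm (Q *v x) \<le> norm x / (1 + lambda_min \<Omega>)\<close>.\<close>

lemma shift_matrix_inverse:
  fixes \<Omega> :: "real^'n^'n"
  assumes \<Omega>: "sym_mat \<Omega>" "psd_mat \<Omega>"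
  defines "Q \<equiv> matrix_inv (mat 1 + \<Omega>)"
  shows "sym_mat Q" "pd_mat Q" "\<Omega> *v (Q *v x) = x - Q *v x" "0 \<le> lambda_min \<Omega>"
    "x \<bullet> (Q *v x) \<le> (norm x)\<^sup>2 / (1 + lambda_min \<Omega>)"
proof -
  have mv: "(mat 1 + \<Omega>) *v x = x + \<Omega> *v x" for x
    by (simp add: matrix_vector_mult_add_rdistrib)
  have "sym_mat (mat 1 + \<Omega>)"
    using \<Omega>(1) by (auto simp: sym_mat_def transpose_def vec_eq_iff mat_def)
  moreover have "pd_mat (mat 1 + \<Omega>)"
    using \<Omega>(2) by (auto simp: pd_mat_def psd_mat_def mv inner_add_right add_pos_nonneg)
  ultimately have inv: "sym_mat Q" "pd_mat Q" "\<And>x. (mat 1 + \<Omega>) *v (Q *v x) = x"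
    unfolding Q_def by (auto intro: pd_mat_inverse)
  then show "sym_mat Q" "pd_mat Q" by auto
  show Qx: "\<Omega> *v (Q *v x) = x - Q *v x" for x
    using inv(3)[of x] by (simp add: mv algebra_simps)
  let ?m = "lambda_min \<Omega>"
  \<comment> \<open>The smallest eigenvalue is attained at an eigenvector, where semidefiniteness
    fixes its sign.\<close>
  obtain v where v: "v \<noteq> 0" "\<Omega> *v v = ?m *\<^sub>R v"
    using lambda_min_symmetric(1)[OF \<Omega>(1)] by (auto simp: eigenvals_def)
  have "0 \<le> v \<bullet> (\<Omega> *v v)" using \<Omega>(2) by (simp add: psd_mat_def)
  moreover have "0 < v \<bullet> v" using v(1) by simp
  ultimately show m: "0 \<le> ?m" using v(2) by (simp add: zero_le_mult_iff not_le[symmetric])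
  have "(1 + ?m) * (norm (Q *v x))\<^sup>2 \<le> (Q *v x) \<bullet> x"
    using lambda_min_symmetric(2)[OF \<Omega>(1), of "Q *v x"]
    by (simp add: Qx inner_diff_right power2_norm_eq_inner algebra_simps)
  also have "\<dots> \<le> norm (Q *v x) * norm x" by (rule norm_cauchy_schwarz)
  finally have "(1 + ?m) * norm (Q *v x) \<le> norm x"
    by (cases "norm (Q *v x) = 0") (auto simp: power2_eq_square mult.left_commute)
  then have "norm (Q *v x) \<le> norm x / (1 + ?m)" using m by (simp add: field_simps)
  then have "norm x * norm (Q *v x) \<le> norm x * (norm x / (1 + ?m))"
    by (rule mult_left_mono) simp
  then show "x \<bullet> (Q *v x) \<le> (norm x)\<^sup>2 / (1 + ?m)"
    using norm_cauchy_schwarz[of x "Q *v x"] by (simp add: power2_eq_square)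
qed

text \<open>Here \<open>d\<close> and \<open>e\<close> are the deviations of \<open>g\<close> and \<open>h\<close> from \<open>hs\<close>.\<close>

lemma matrix_compressor_contraction:
  fixes Cm :: "'s \<Rightarrow> real^'n \<Rightarrow> real^'n" and d e :: "real^'n"
  assumes Cm: "matrix_compressor \<Omega> S Cm" and \<Omega>: "sym_mat \<Omega>" "psd_mat \<Omega>" and "0 \<le> K" "0 \<le> b"
  defines "Q \<equiv> matrix_inv (mat 1 + \<Omega>)"
  shows "(\<integral>\<^sup>+s. ennreal (b + K * (norm (d - Q *v Cm s (d - e)))\<^sup>2) \<partial>S)
      \<le> ennreal (b + K * (d \<bullet> d - d \<bullet> (Q *v d) + e \<bullet> (Q *v e)))"
proof -
  let ?z = "d - e"
  note Q = shift_matrix_inverse[OF \<Omega>, folded Q_def]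
  note c = Cm[unfolded matrix_compressor_def randomized_operator_def unbiased_operator_def,
      folded Q_def]
  interpret prob_space S using c by blast
  have lin: "bounded_linear ((*v) Q)" by (rule matrix_vector_mul_bounded_linear)
  have "integrable S (\<lambda>s. Q *v Cm s ?z)" "(\<integral>s. Q *v Cm s ?z \<partial>S) = Q *v ?z"
    using c by (auto simp: integral_bounded_linear[OF lin] intro!: integrable_bounded_linear[OF lin])
  moreover have "0 \<le> ?z \<bullet> (Q *v ?z)"
    using Q(2) unfolding pd_mat_def by (cases "?z = 0") (auto intro: less_imp_le)
  moreover have "(\<integral>\<^sup>+s. ennreal ((norm (Q *v Cm s ?z))\<^sup>2) \<partial>S) \<le> ennreal (?z \<bullet> (Q *v ?z))"
    using c by (simp add: sqnorm_wrt_def)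
  ultimately have dev: "integrable S (\<lambda>s. (norm (d - Q *v Cm s ?z))\<^sup>2)"
      "(\<integral>s. (norm (d - Q *v Cm s ?z))\<^sup>2 \<partial>S) \<le> (norm d)\<^sup>2 - 2 * (d \<bullet> (Q *v ?z)) + ?z \<bullet> (Q *v ?z)"
    using second_moment_deviation[where c = "\<lambda>s. Q *v Cm s ?z" and S = S and k = 1 and a = d]
      prob_space_axioms by auto
  \<comment> \<open>Symmetry of \<open>Q\<close> cancels the mixed terms
    \<open>d \<bullet> (Q *v e)\<close>, which separates the estimator error from the shift
    error.\<close>
  have "(norm d)\<^sup>2 - 2 * (d \<bullet> (Q *v ?z)) + ?z \<bullet> (Q *v ?z) = d \<bullet> d - d \<bullet> (Q *v d) + e \<bullet> (Q *v e)"
    using sym_mat_inner[OF Q(1), of d e]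
    by (simp add: power2_norm_eq_inner matrix_vector_mult_diff_distrib inner_diff_left
        inner_diff_right inner_commute)
  then have "K * (\<integral>s. (norm (d - Q *v Cm s ?z))\<^sup>2 \<partial>S) \<le> K * (d \<bullet> d - d \<bullet> (Q *v d) + e \<bullet> (Q *v e))"
    using dev(2) \<open>0 \<le> K\<close> by (intro mult_left_mono) auto
  then have "(\<integral>s. b + K * (norm (d - Q *v Cm s ?z))\<^sup>2 \<partial>S) \<le> b + K * (d \<bullet> d - d \<bullet> (Q *v d) + e \<bullet> (Q *v e))"
    using dev(1) by (simp add: prob_space)
  moreover have "(\<integral>\<^sup>+s. ennreal (b + K * (norm (d - Q *v Cm s ?z))\<^sup>2) \<partial>S) =
      ennreal (\<integral>s. b + K * (norm (d - Q *v Cm s ?z))\<^sup>2 \<partial>S)"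
    using dev(1) \<open>0 \<le> K\<close> \<open>0 \<le> b\<close> by (intro nn_integral_eq_integral) auto
  ultimately show ?thesis by (simp only: ennreal_leI)
qed

text \<open>Since \<open>\<Omega> ** Q = mat 1 - Q\<close>, the matrix \<open>T\<close> is symmetric
  and its form is the left-hand side. The eigenvalue equation of \<open>L ** T\<close> is that of
  the pair \<open>T\<close>, \<open>matrix_inv L\<close>, which brings in
  \<open>lambda_max\<close>.\<close>

lemma noise_matrix_bound:
  fixes L \<Omega> :: "real^'n^'n"
  assumes \<Omega>: "sym_mat \<Omega>" "psd_mat \<Omega>" and L: "sym_mat L" "pd_mat L" and "0 \<le> k"
  defines "Q \<equiv> matrix_inv (mat 1 + \<Omega>)"
  defines "lam \<equiv> lambda_max (L ** (mat 1 + k *\<^sub>R (\<Omega> ** Q)))"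
  shows "d \<bullet> d + k * (d \<bullet> d - d \<bullet> (Q *v d)) \<le> lam * sqnorm_wrt (matrix_inv L) d"
    and "0 < lam"
proof -
  note Q = shift_matrix_inverse[OF \<Omega>, folded Q_def]
  note Li = pd_mat_inverse[OF L]
  define T where "T = mat 1 + k *\<^sub>R (\<Omega> ** Q)"
  have T: "T *v x = x + k *\<^sub>R (x - Q *v x)" for x
    by (simp add: T_def matrix_vector_mult_add_rdistrib scaleR_matrix_vector_assoc[symmetric]
        matrix_vector_mul_assoc[symmetric] Q(3))
  have T_eq: "T = mat 1 + k *\<^sub>R (mat 1 - Q)"
    by (simp add: matrix_eq T matrix_vector_mult_add_rdistrib matrix_vector_mult_diff_rdistrib
        scaleR_matrix_vector_assoc[symmetric])
  have "sym_mat T"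
    using Q(1) by (auto simp: T_eq sym_mat_def transpose_def vec_eq_iff mat_def)
  moreover have "(L ** T) *v v = l *\<^sub>R v \<longleftrightarrow> T *v v = l *\<^sub>R (matrix_inv L *v v)" for l v
  proof -
    have "(L ** T) *v v = L *v (T *v v)" by (simp add: matrix_vector_mul_assoc)
    then show ?thesis
      using Li(1)[of v] Li(2)[of "T *v v"] by (metis matrix_vector_mult_scaleR)
  qed
  ultimately have bound: "d \<bullet> (T *v d) \<le> lam * (d \<bullet> (matrix_inv L *v d))" for d
    unfolding lam_def T_def[symmetric] by (intro inner_le_lambda_max Li(3,4))
  then show "d \<bullet> d + k * (d \<bullet> d - d \<bullet> (Q *v d)) \<le> lam * sqnorm_wrt (matrix_inv L) d"
    by (simp add: T inner_add_right inner_diff_right sqnorm_wrt_def)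
  \<comment> \<open>At any nonzero vector the form of \<open>T\<close> is positive, and so is that
    of \<open>matrix_inv L\<close>; the bound just proved then forces \<open>lam\<close> to be
    positive.\<close>
  define v :: "real^'n" where "v = axis undefined 1"
  have "v \<noteq> 0" by (simp add: v_def axis_eq_0_iff)
  have "v \<bullet> (Q *v v) \<le> v \<bullet> v / (1 + lambda_min \<Omega>)"
    using Q(5)[of v] by (simp add: power2_norm_eq_inner)
  also have "\<dots> \<le> v \<bullet> v" using Q(4) by (simp add: divide_le_eq mult_left_le field_simps)
  finally have "0 \<le> k * (v \<bullet> v - v \<bullet> (Q *v v))" using \<open>0 \<le> k\<close> by simp
  moreover have "0 < v \<bullet> v" using \<open>v \<noteq> 0\<close> by simp
  moreover have "v \<bullet> (T *v v) = v \<bullet> v + k * (v \<bullet> v - v \<bullet> (Q *v v))"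
    by (simp add: T inner_add_right inner_diff_right)
  ultimately have "0 < v \<bullet> (T *v v)" by linarith
  also have "\<dots> \<le> lam * (v \<bullet> (matrix_inv L *v v))" by (rule bound)
  finally have "0 < lam * (v \<bullet> (matrix_inv L *v v))" .
  moreover have "0 < v \<bullet> (matrix_inv L *v v)" using Li(4) \<open>v \<noteq> 0\<close> by (simp add: pd_mat_def)
  ultimately show "0 < lam" by (rule zero_less_mult_pos2)
qed

subsection \<open>One iteration in expectation\<close>

lemma measurable_wrt_generated:
  assumes "X \<in> measurable M N" "sets (gen_algebra M N X) \<subseteq> G" "G \<subseteq> Pow (space M)"
  shows "X \<in> measurable (sigma (space M) G) N"
proof (rule measurableI)
  show "X w \<in> space N" if "w \<in> space (sigma (space M) G)" for w
    using that measurable_space[OF assms(1)] by (simp add: space_measure_of_conv)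
  fix A assume A: "A \<in> sets N"
  have "X -` A \<inter> space M \<in> sets (gen_algebra M N X)"
    unfolding gen_algebra_def by (rule in_vimage_algebra[OF A])
  then show "X -` A \<inter> space (sigma (space M) G) \<in> sets (sigma (space M) G)"
    using assms(2,3) by auto
qed

lemma sets_gen_algebra_subset:
  assumes "X \<in> measurable M N"
  shows "sets (gen_algebra M N X) \<subseteq> sets M"
proof -
  have "X \<in> space M \<rightarrow> space N" using assms by (auto simp: measurable_space)
  then show ?thesis
    unfolding gen_algebra_def sets_vimage_algebra2[OF \<open>X \<in> space M \<rightarrow> space N\<close>]
    using measurable_sets[OF assms] by blast
qed

text \<open>By independence the joint law of \<open>\<xi>\<close> and \<open>Z\<close> is the
  product of \<open>S\<close> with the law of \<open>Z\<close>, as checked on rectangles. Tonelli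
  then averages over the seed alone with \<open>Z\<close> frozen.\<close>

lemma nn_integral_fresh_seed:
  fixes \<phi> :: "'s \<Rightarrow> 'z \<Rightarrow> ennreal"
  assumes M: "prob_space M"
    and \<xi>: "\<xi> \<in> measurable M S" "distr M S \<xi> = S"
    and indep: "prob_space.indep_set M (sets (gen_algebra M S \<xi>)) G"
    and G: "sigma_algebra (space M) G"
    and Z: "Z \<in> measurable (sigma (space M) G) N"
    and \<phi>: "(\<lambda>(s, z). \<phi> s z) \<in> borel_measurable (S \<Otimes>\<^sub>M N)"
  shows "(\<integral>\<^sup>+w. \<phi> (\<xi> w) (Z w) \<partial>M) = (\<integral>\<^sup>+w. (\<integral>\<^sup>+s. \<phi> s (Z w) \<partial>S) \<partial>M)"
proof -
  interpret prob_space M by fact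
  interpret G: sigma_algebra "space M" G by fact
  interpret S: prob_space S using prob_space_distr[OF \<xi>(1)] \<xi>(2) by simp
  have GM: "G \<subseteq> events" by (rule indep_setD_ev2[OF indep])
  have vimage: "Z -` A \<inter> space M \<in> G" if "A \<in> sets N" for A
    using measurable_sets[OF Z that] G.space_closed by (simp add: G.sigma_sets_eq)
  have ZM[measurable]: "Z \<in> measurable M N"
    using Z vimage GM by (intro measurableI) (auto dest: measurable_space)
  note \<xi>(1)[measurable] \<phi>[measurable]
  interpret Z: prob_space "distr M N Z" by (rule prob_space_distr) (rule ZM)
  have joint: "S \<Otimes>\<^sub>M distr M N Z = distr M (S \<Otimes>\<^sub>M N) (\<lambda>w. (\<xi> w, Z w))"
  proof (rule pair_measure_eqI)
    fix A B assume A: "A \<in> sets S" and B: "B \<in> sets (distr M N Z)"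
    let ?a = "\<xi> -` A \<inter> space M" and ?b = "Z -` B \<inter> space M"
    have "?a \<in> sets (gen_algebra M S \<xi>)"
      unfolding gen_algebra_def by (rule in_vimage_algebra[OF A])
    then have "prob (?a \<inter> ?b) = prob ?a * prob ?b"
      using B vimage[of B] by (intro indep_setD[OF indep]) auto
    moreover have "emeasure S A = emeasure M ?a"
      using emeasure_distr[OF \<xi>(1) A] \<xi>(2) by simp
    moreover have "(\<lambda>w. (\<xi> w, Z w)) -` (A \<times> B) \<inter> space M = ?a \<inter> ?b" by auto
    ultimately show "emeasure S A * emeasure (distr M N Z) B =
        emeasure (distr M (S \<Otimes>\<^sub>M N) (\<lambda>w. (\<xi> w, Z w))) (A \<times> B)"
      using A B by (simp add: emeasure_distr emeasure_eq_measure ennreal_mult[symmetric])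
  qed (auto simp: S.sigma_finite_measure_axioms Z.sigma_finite_measure_axioms cong: sets_pair_measure_cong)
  interpret pair_sigma_finite S "distr M N Z" ..
  have "(\<integral>\<^sup>+w. \<phi> (\<xi> w) (Z w) \<partial>M) = (\<integral>\<^sup>+p. (\<lambda>(s, z). \<phi> s z) p \<partial>distr M (S \<Otimes>\<^sub>M N) (\<lambda>w. (\<xi> w, Z w)))"
    by (subst nn_integral_distr) auto
  also have "\<dots> = (\<integral>\<^sup>+z. (\<integral>\<^sup>+s. \<phi> s z \<partial>S) \<partial>distr M N Z)"
    unfolding joint[symmetric] by (subst nn_integral_snd[symmetric]) auto
  also have "\<dots> = (\<integral>\<^sup>+w. (\<integral>\<^sup>+s. \<phi> s (Z w) \<partial>S) \<partial>M)"
    by (subst nn_integral_distr) auto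
  finally show ?thesis .
qed

lemma matrix_vector_mult_borel_measurable [measurable (raw)]:
  fixes Q :: "real^'n^'m"
  assumes "f \<in> borel_measurable F"
  shows "(\<lambda>w. Q *v f w) \<in> borel_measurable F"
  by (rule measurable_compose[OF assms])
    (intro borel_measurable_continuous_onI matrix_vector_mult_linear_continuous_on)

lemma randomized_operator_measurable:
  assumes "randomized_operator S C" "f \<in> measurable F S" "g \<in> borel_measurable F"
  shows "(\<lambda>w. C (f w) (g w)) \<in> borel_measurable F"
proof -
  have "(\<lambda>w. (f w, g w)) \<in> measurable F (S \<Otimes>\<^sub>M borel)" using assms by measurable
  from measurable_compose[OF this, of "\<lambda>(s, x). C s x" borel] show ?thesis
    using assms(1) by (simp add: randomized_operator_def)
qed

text \<open>Both updates subtract a multiple of the same compressor output. Multiplied by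
  \<open>\<tau>\<close>, the second multiple also becomes \<open>1 / (1 + \<omega>)\<close>, which
  explains the weight \<open>\<tau>\<^sup>2\<close> of the shift error.\<close>

lemma vr_gradskip_step_eq:
  fixes \<gamma> \<omega> :: real and \<Omega> :: "real^'n^'n" and \<psi> :: "real^'n \<Rightarrow> ereal"
    and Cm Cs :: "real^'n \<Rightarrow> real^'n" and g h x :: "real^'n"
  assumes "\<gamma> > 0" "\<omega> \<ge> 0"
  defines "\<tau> \<equiv> \<gamma> * (1 + \<omega>)"
  defines "hh \<equiv> g - matrix_inv (mat 1 + \<Omega>) *v Cm (g - h)"
  defines "xh \<equiv> x - \<gamma> *\<^sub>R (g - hh)"
  defines "c \<equiv> Cs (xh - prox (\<lambda>u. ereal \<tau> * \<psi> u) (xh - \<tau> *\<^sub>R hh))"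
  shows "vr_gradskip_step \<gamma> \<omega> \<Omega> \<psi> Cm Cs g (x, h) =
    (xh - (1 / (1 + \<omega>)) *\<^sub>R c, hh - (1 / (\<tau> * (1 + \<omega>))) *\<^sub>R c)"
  using assms(1,2) unfolding vr_gradskip_step_def Let_def assms(3-6) by simp

text \<open>The seeds are averaged out in reverse order of their use: first \<open>\<eta>\<close>
  with the intermediate state frozen, then \<open>\<xi>\<close> with \<open>x\<close>,
  \<open>h\<close> and \<open>g\<close> frozen.\<close>

lemma vr_gradskip_step_expectation:
  fixes \<gamma> \<omega> :: real and \<Omega> :: "real^'n^'n" and \<psi> :: "real^'n \<Rightarrow> ereal"
    and x h g x' h' :: "'a \<Rightarrow> real^'n" and xs hs :: "real^'n"
  assumes M: "prob_space M"
    and Cs: "scalar_compressor \<omega> R Cs" and Cm: "matrix_compressor \<Omega> S Cm"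
    and \<Omega>: "sym_mat \<Omega>" "psd_mat \<Omega>" and \<gamma>: "\<gamma> > 0" and \<omega>: "\<omega> \<ge> 0"
    and \<xi>: "\<xi> \<in> measurable M S" "distr M S \<xi> = S"
    and \<eta>: "\<eta> \<in> measurable M R" "distr M R \<eta> = R"
    and G: "sigma_algebra (space M) G"
    and indep_\<xi>: "prob_space.indep_set M (sets (gen_algebra M S \<xi>)) G"
    and indep_\<eta>: "prob_space.indep_set M (sets (gen_algebra M R \<eta>))
        (sigma_sets (space M) (G \<union> sets (gen_algebra M S \<xi>)))"
    and meas: "x \<in> borel_measurable (sigma (space M) G)" "h \<in> borel_measurable (sigma (space M) G)"
      "g \<in> borel_measurable (sigma (space M) G)"
    and prox: "prox (\<lambda>u. ereal (\<gamma> * (1 + \<omega>)) * \<psi> u) \<in> borel_measurable borel"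
    and firm: "\<And>p. (prox (\<lambda>u. ereal (\<gamma> * (1 + \<omega>)) * \<psi> u) p - xs) \<bullet> (prox (\<lambda>u. ereal (\<gamma> * (1 + \<omega>)) * \<psi> u) p - xs)
      \<le> (p - (xs - (\<gamma> * (1 + \<omega>)) *\<^sub>R hs)) \<bullet> (prox (\<lambda>u. ereal (\<gamma> * (1 + \<omega>)) * \<psi> u) p - xs)"
    and step: "\<And>w. w \<in> space M \<Longrightarrow>
      (x' w, h' w) = vr_gradskip_step \<gamma> \<omega> \<Omega> \<psi> (Cm (\<xi> w)) (Cs (\<eta> w)) (g w) (x w, h w)"
  defines "Q \<equiv> matrix_inv (mat 1 + \<Omega>)"
  shows "(\<integral>\<^sup>+w. ennreal ((norm (x' w - xs))\<^sup>2 + \<gamma>\<^sup>2 * (1 + \<omega>)\<^sup>2 * (norm (h' w - hs))\<^sup>2) \<partial>M)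
    \<le> (\<integral>\<^sup>+w. ennreal ((norm (x w - xs - \<gamma> *\<^sub>R (g w - hs)))\<^sup>2 + \<gamma>\<^sup>2 * (\<omega> * (\<omega> + 2)) *
          ((g w - hs) \<bullet> (g w - hs) - (g w - hs) \<bullet> (Q *v (g w - hs)) + (h w - hs) \<bullet> (Q *v (h w - hs)))) \<partial>M)"
proof -
  interpret prob_space M by fact
  define \<tau> where "\<tau> = \<gamma> * (1 + \<omega>)"
  have \<tau>: "\<tau> > 0" using \<gamma> \<omega> by (simp add: \<tau>_def)
  define P where "P = prox (\<lambda>u. ereal \<tau> * \<psi> u)"
  have [measurable]: "P \<in> borel_measurable borel" using prox by (simp add: P_def \<tau>_def)
  have Rs: "randomized_operator R Cs" and Rm: "randomized_operator S Cm"
    using Cs Cm by (auto simp: scalar_compressor_def matrix_compressor_def)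
  note [measurable (raw)] = randomized_operator_measurable[OF Rs] randomized_operator_measurable[OF Rm]
  \<comment> \<open>\<open>H\<close> adds the matrix seed to the past: it makes \<open>hh\<close>
    and \<open>xh\<close> measurable and is still independent of \<open>\<eta>\<close>.\<close>
  define H where "H = sigma_sets (space M) (G \<union> sets (gen_algebra M S \<xi>))"
  have GH: "G \<subseteq> H" "sets (gen_algebra M S \<xi>) \<subseteq> H" by (auto simp: H_def)
  have GP: "G \<subseteq> Pow (space M)" using G by (simp add: sigma_algebra_iff2)
  have gen_sub: "G \<union> sets (gen_algebra M S \<xi>) \<subseteq> Pow (space M)"
    using GP sets_gen_algebra_subset[OF \<xi>(1)] sets.space_closed[of M] by blast
  have H: "sigma_algebra (space M) H" unfolding H_def by (rule sigma_algebra_sigma_sets[OF gen_sub])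
  then have HP: "H \<subseteq> Pow (space M)" by (simp add: sigma_algebra_iff2)
  have up: "X \<in> borel_measurable (sigma (space M) H)" if "X \<in> borel_measurable (sigma (space M) G)"
    for X :: "'a \<Rightarrow> real^'n"
    using that measurable_mono[of borel borel "sigma (space M) G" "sigma (space M) H"] GP HP GH(1)
    by (auto simp: sigma_sets_mono')
  note [measurable] = meas[THEN up] measurable_wrt_generated[OF \<xi>(1) GH(2) HP]
  define hh where "hh = (\<lambda>w. g w - Q *v Cm (\<xi> w) (g w - h w))"
  define xh where "xh = (\<lambda>w. x w - \<gamma> *\<^sub>R (g w - hh w))"
  have [measurable]: "hh \<in> borel_measurable (sigma (space M) H)" "xh \<in> borel_measurable (sigma (space M) H)"
    unfolding hh_def xh_def by measurable
  \<comment> \<open>The integrand as a function of the scalar seed and the intermediate state, with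
    \<open>\<tau>\<close> moved inside the norm of the shift error.\<close>
  define \<phi> where "\<phi> = (\<lambda>r (y, z). ennreal (
      (norm ((y - xs) - (1 / (1 + \<omega>)) *\<^sub>R Cs r (y - P (y - \<tau> *\<^sub>R z))))\<^sup>2 +
      (norm (\<tau> *\<^sub>R (z - hs) - (1 / (1 + \<omega>)) *\<^sub>R Cs r (y - P (y - \<tau> *\<^sub>R z))))\<^sup>2))"
  have \<phi>_meas: "(\<lambda>(r, p). \<phi> r p) \<in> borel_measurable (R \<Otimes>\<^sub>M (borel \<Otimes>\<^sub>M borel))"
    unfolding \<phi>_def split_def by measurable
  define \<phi>' where "\<phi>' = (\<lambda>s (y, z, v). ennreal ((norm (y - xs - \<gamma> *\<^sub>R (v - hs)))\<^sup>2 +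
      \<gamma>\<^sup>2 * (\<omega> * (\<omega> + 2)) * (norm ((v - hs) - Q *v Cm s ((v - hs) - (z - hs))))\<^sup>2))"
  have \<phi>'_meas: "(\<lambda>(s, p). \<phi>' s p) \<in> borel_measurable (S \<Otimes>\<^sub>M (borel \<Otimes>\<^sub>M borel \<Otimes>\<^sub>M borel))"
    unfolding \<phi>'_def split_def by measurable
  have "(\<integral>\<^sup>+w. ennreal ((norm (x' w - xs))\<^sup>2 + \<gamma>\<^sup>2 * (1 + \<omega>)\<^sup>2 * (norm (h' w - hs))\<^sup>2) \<partial>M)
      = (\<integral>\<^sup>+w. \<phi> (\<eta> w) (xh w, hh w) \<partial>M)"
  proof (rule nn_integral_cong)
    fix w assume w: "w \<in> space M"
    let ?c = "Cs (\<eta> w) (xh w - P (xh w - \<tau> *\<^sub>R hh w))"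
    have eqs: "x' w = xh w - (1 / (1 + \<omega>)) *\<^sub>R ?c" "h' w = hh w - (1 / (\<tau> * (1 + \<omega>))) *\<^sub>R ?c"
      using step[OF w] unfolding vr_gradskip_step_eq[OF \<gamma> \<omega>]
      by (simp_all add: P_def \<tau>_def hh_def xh_def Q_def)
    have "\<tau> *\<^sub>R (h' w - hs) = \<tau> *\<^sub>R (hh w - hs) - (1 / (1 + \<omega>)) *\<^sub>R ?c"
      unfolding eqs using \<tau> by (simp add: scaleR_diff_right)
    moreover have "\<gamma>\<^sup>2 * (1 + \<omega>)\<^sup>2 * (norm (h' w - hs))\<^sup>2 = (norm (\<tau> *\<^sub>R (h' w - hs)))\<^sup>2"
      by (simp add: \<tau>_def power_mult_distrib)
    moreover have "x' w - xs = (xh w - xs) - (1 / (1 + \<omega>)) *\<^sub>R ?c" unfolding eqs by simp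
    ultimately show "ennreal ((norm (x' w - xs))\<^sup>2 + \<gamma>\<^sup>2 * (1 + \<omega>)\<^sup>2 * (norm (h' w - hs))\<^sup>2)
        = \<phi> (\<eta> w) (xh w, hh w)"
      by (simp only: \<phi>_def prod.case)
  qed
  also have "\<dots> = (\<integral>\<^sup>+w. (\<integral>\<^sup>+r. \<phi> r (xh w, hh w) \<partial>R) \<partial>M)"
    by (rule nn_integral_fresh_seed[OF M \<eta> indep_\<eta>[folded H_def] H _ \<phi>_meas]) measurable
  also have "\<dots> \<le> (\<integral>\<^sup>+w. ennreal ((norm (xh w - xs - \<gamma> *\<^sub>R (hh w - hs)))\<^sup>2 +
      \<gamma>\<^sup>2 * (\<omega> * (\<omega> + 2)) * (norm (hh w - hs))\<^sup>2) \<partial>M)"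
  proof (rule nn_integral_mono)
    fix w
    let ?q = "P (xh w - \<tau> *\<^sub>R hh w) - xs"
    have "?q \<bullet> ?q \<le> ((xh w - xs) - \<tau> *\<^sub>R (hh w - hs)) \<bullet> ?q"
      using firm[of "xh w - \<tau> *\<^sub>R hh w", folded \<tau>_def] unfolding P_def by (simp add: algebra_simps)
    from scalar_compressor_contraction[OF Cs \<omega> this[unfolded \<tau>_def]]
    show "(\<integral>\<^sup>+r. \<phi> r (xh w, hh w) \<partial>R) \<le> ennreal ((norm (xh w - xs - \<gamma> *\<^sub>R (hh w - hs)))\<^sup>2 +
      \<gamma>\<^sup>2 * (\<omega> * (\<omega> + 2)) * (norm (hh w - hs))\<^sup>2)"
      by (simp add: \<phi>_def \<tau>_def)
  qed
  also have "(\<integral>\<^sup>+w. ennreal ((norm (xh w - xs - \<gamma> *\<^sub>R (hh w - hs)))\<^sup>2 +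
      \<gamma>\<^sup>2 * (\<omega> * (\<omega> + 2)) * (norm (hh w - hs))\<^sup>2) \<partial>M) = (\<integral>\<^sup>+w. \<phi>' (\<xi> w) (x w, h w, g w) \<partial>M)"
  proof (rule nn_integral_cong)
    fix w
    \<comment> \<open>\<open>hh\<close> cancels because \<open>xh\<close> is
      \<open>x - \<gamma> *\<^sub>R (g - hh)\<close>; the matrix seed survives only in the second
      term.\<close>
    have "xh w - xs - \<gamma> *\<^sub>R (hh w - hs) = x w - xs - \<gamma> *\<^sub>R (g w - hs)"
      by (simp add: xh_def algebra_simps)
    moreover have "hh w - hs = (g w - hs) - Q *v Cm (\<xi> w) ((g w - hs) - (h w - hs))"
      by (simp add: hh_def)
    ultimately show "ennreal ((norm (xh w - xs - \<gamma> *\<^sub>R (hh w - hs)))\<^sup>2 +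
      \<gamma>\<^sup>2 * (\<omega> * (\<omega> + 2)) * (norm (hh w - hs))\<^sup>2) = \<phi>' (\<xi> w) (x w, h w, g w)"
      by (simp only: \<phi>'_def prod.case)
  qed
  also have "\<dots> = (\<integral>\<^sup>+w. (\<integral>\<^sup>+s. \<phi>' s (x w, h w, g w) \<partial>S) \<partial>M)"
    by (intro nn_integral_fresh_seed[OF M \<xi> indep_\<xi> G _ \<phi>'_meas] measurable_Pair meas)
  also have "\<dots> \<le> (\<integral>\<^sup>+w. ennreal ((norm (x w - xs - \<gamma> *\<^sub>R (g w - hs)))\<^sup>2 + \<gamma>\<^sup>2 * (\<omega> * (\<omega> + 2)) *
          ((g w - hs) \<bullet> (g w - hs) - (g w - hs) \<bullet> (Q *v (g w - hs)) + (h w - hs) \<bullet> (Q *v (h w - hs)))) \<partial>M)"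
    unfolding \<phi>'_def prod.case Q_def using \<omega>
    by (intro nn_integral_mono matrix_compressor_contraction[OF Cm \<Omega>]) auto
  finally show ?thesis .
qed

section \<open>Information available at each iteration\<close>

lemma past_events_props:
  assumes fresh: "fresh_seeds M S R g \<sigma> \<xi> \<eta>"
    and meas: "\<And>t. g t \<in> borel_measurable M" "\<And>t. \<sigma> t \<in> borel_measurable M"
  defines "G \<equiv> past_events M S R g \<sigma> \<xi> \<eta>"
  shows "sigma_algebra (space M) (G t)" "G t \<subseteq> sets M" "s \<le> t \<Longrightarrow> G s \<subseteq> G t"
    "s \<le> t \<Longrightarrow> sets (gen_algebra M borel (g s)) \<subseteq> G t"
    "s < t \<Longrightarrow> sets (gen_algebra M S (\<xi> s)) \<subseteq> G t"
    "s < t \<Longrightarrow> sets (gen_algebra M R (\<eta> s)) \<subseteq> G t"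
proof -
  have sub: "(\<Union>k\<le>t. sets (gen_algebra M borel (g k)) \<union> sets (gen_algebra M borel (\<sigma> k))) \<union>
        (\<Union>k<t. sets (gen_algebra M S (\<xi> k)) \<union> sets (gen_algebra M R (\<eta> k))) \<subseteq> sets M"
    using fresh meas unfolding fresh_seeds_def
    by (intro Un_least UN_least sets_gen_algebra_subset) auto
  show "G t \<subseteq> sets M"
    unfolding G_def past_events_def by (rule sets.sigma_sets_subset[OF sub])
  show "sigma_algebra (space M) (G t)"
    unfolding G_def past_events_def
    using sub sets.space_closed[of M] by (intro sigma_algebra_sigma_sets) blast
  show "s \<le> t \<Longrightarrow> G s \<subseteq> G t"
    unfolding G_def past_events_def by (intro sigma_sets_mono') fastforce
qed (unfold G_def past_events_def; intro subsetI sigma_sets.Basic; blast)+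

text \<open>The new state is a measurable function of the old one, of \<open>g t\<close> and of the
  seeds \<open>\<xi> t\<close> and \<open>\<eta> t\<close>, all in the past of \<open>Suc t\<close>.
  Together with freshness this makes the current matrix seed independent of the current
  state.\<close>

lemma iterates_measurable:
  fixes x h g :: "nat \<Rightarrow> 'a \<Rightarrow> real^'n"
  assumes fresh: "fresh_seeds M S R g \<sigma> \<xi> \<eta>"
    and meas: "\<And>t. g t \<in> borel_measurable M" "\<And>t. \<sigma> t \<in> borel_measurable M"
    and run: "vr_gradskip_run M \<gamma> \<omega> \<Omega> \<psi> Cm Cs \<xi> \<eta> g x0 h0 x h"
    and C: "randomized_operator S Cm" "randomized_operator R Cs"
    and pos: "\<gamma> > 0" "\<omega> \<ge> 0"
    and prox: "prox (\<lambda>u. ereal (\<gamma> * (1 + \<omega>)) * \<psi> u) \<in> borel_measurable borel"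
  defines "F \<equiv> \<lambda>t. sigma (space M) (past_events M S R g \<sigma> \<xi> \<eta> t)"
  shows "x t \<in> borel_measurable (F t) \<and> h t \<in> borel_measurable (F t)"
proof (induction t)
  note past = past_events_props[OF fresh meas]
  have space_F: "space (F t) = space M" for t by (simp add: F_def space_measure_of_conv)
  have step: "x 0 w = x0" "h 0 w = h0" "(x (Suc t) w, h (Suc t) w) =
      vr_gradskip_step \<gamma> \<omega> \<Omega> \<psi> (Cm (\<xi> t w)) (Cs (\<eta> t w)) (g t w) (x t w, h t w)"
    if "w \<in> space M" for w t
    using run that unfolding vr_gradskip_run_def by auto
  {
    case 0
    have "x 0 \<in> borel_measurable (F 0) \<longleftrightarrow> (\<lambda>_. x0) \<in> borel_measurable (F 0)"
      "h 0 \<in> borel_measurable (F 0) \<longleftrightarrow> (\<lambda>_. h0) \<in> borel_measurable (F 0)"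
      by (intro measurable_cong; simp add: step space_F)+
    then show ?case by simp
  next
    case (Suc t)
    have P: "past_events M S R g \<sigma> \<xi> \<eta> t \<subseteq> Pow (space M)" for t
      using past(2)[of t] sets.space_closed[of M] by blast
    have up: "X \<in> borel_measurable (F (Suc t))" if "X \<in> borel_measurable (F t)" for X :: "'a \<Rightarrow> real^'n"
      using that measurable_mono[of borel borel "F t" "F (Suc t)"] P past(3)[of t "Suc t"]
      by (auto simp: F_def space_measure_of_conv sigma_sets_mono')
    have \<xi>\<eta>: "\<xi> t \<in> measurable M S" "\<eta> t \<in> measurable M R"
      using fresh by (auto simp: fresh_seeds_def)
    have [measurable]: "x t \<in> borel_measurable (F (Suc t))" "h t \<in> borel_measurable (F (Suc t))"
      using up[OF conjunct1[OF Suc]] up[OF conjunct2[OF Suc]] .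
    have [measurable]: "g t \<in> borel_measurable (F (Suc t))"
      unfolding F_def by (rule measurable_wrt_generated[OF meas(1) past(4) P]) simp
    have [measurable]: "\<xi> t \<in> measurable (F (Suc t)) S"
      unfolding F_def by (rule measurable_wrt_generated[OF \<xi>\<eta>(1) past(5) P]) simp
    have [measurable]: "\<eta> t \<in> measurable (F (Suc t)) R"
      unfolding F_def by (rule measurable_wrt_generated[OF \<xi>\<eta>(2) past(6) P]) simp
    note prox[measurable]
    note [measurable (raw)] = C[THEN randomized_operator_measurable]
    define hh where "hh = (\<lambda>w. g t w - matrix_inv (mat 1 + \<Omega>) *v Cm (\<xi> t w) (g t w - h t w))"
    define xh where "xh = (\<lambda>w. x t w - \<gamma> *\<^sub>R (g t w - hh w))"
    define c where "c = (\<lambda>w. Cs (\<eta> t w) (xh w - prox (\<lambda>u. ereal (\<gamma> * (1 + \<omega>)) * \<psi> u)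
        (xh w - (\<gamma> * (1 + \<omega>)) *\<^sub>R hh w)))"
    have [measurable]: "hh \<in> borel_measurable (F (Suc t))" unfolding hh_def by measurable
    have [measurable]: "xh \<in> borel_measurable (F (Suc t))" unfolding xh_def by measurable
    have [measurable]: "c \<in> borel_measurable (F (Suc t))" unfolding c_def by measurable
    have eq: "x (Suc t) w = xh w - (1 / (1 + \<omega>)) *\<^sub>R c w"
        "h (Suc t) w = hh w - (1 / (\<gamma> * (1 + \<omega>) * (1 + \<omega>))) *\<^sub>R c w" if "w \<in> space M" for w
      using step(3)[OF that, of t] unfolding vr_gradskip_step_eq[OF pos]
      by (simp_all add: hh_def xh_def c_def)
    \<comment> \<open>The run equations hold only on \<open>space M\<close>, hence the passage
      through congruence.\<close>
    have "x (Suc t) \<in> borel_measurable (F (Suc t)) \<longleftrightarrow>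
        (\<lambda>w. xh w - (1 / (1 + \<omega>)) *\<^sub>R c w) \<in> borel_measurable (F (Suc t))"
      by (intro measurable_cong eq) (simp add: space_F)
    moreover have "h (Suc t) \<in> borel_measurable (F (Suc t)) \<longleftrightarrow>
        (\<lambda>w. hh w - (1 / (\<gamma> * (1 + \<omega>) * (1 + \<omega>))) *\<^sub>R c w) \<in> borel_measurable (F (Suc t))"
      by (intro measurable_cong eq) (simp add: space_F)
    ultimately show ?case by simp
  }
qed

section \<open>From conditional to total expectations\<close>

lemma gen_algebra_subalgebra:
  assumes "X \<in> measurable M N"
  shows "subalgebra M (gen_algebra M N X)"
  using sets_gen_algebra_subset[OF assms] by (simp add: subalgebra_def gen_algebra_def)

text \<open>Conditional expectation preserves the total integral, so the almost sure bound can be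
  integrated. In \<open>ennreal\<close> this is legitimate before integrability of \<open>Y\<close>
  is known, and yields it.\<close>

lemma integrable_of_nn_cond_exp_bound:
  assumes M: "prob_space M" and F: "subalgebra M F"
    and Y: "Y \<in> borel_measurable M" "\<And>w. w \<in> space M \<Longrightarrow> 0 \<le> Y w"
    and Z: "integrable M Z" "\<And>w. w \<in> space M \<Longrightarrow> 0 \<le> Z w"
    and bound: "AE w in M. nn_cond_exp M F (\<lambda>w. ennreal (Y w)) w \<le> ennreal (Z w)"
  shows "integrable M Y" "(\<integral>w. Y w \<partial>M) \<le> (\<integral>w. Z w \<partial>M)"
proof -
  interpret prob_space M by fact
  interpret finite_measure_subalgebra M F by unfold_locales (rule F)
  have "(\<integral>\<^sup>+w. ennreal (Y w) \<partial>M) = (\<integral>\<^sup>+w. nn_cond_exp M F (\<lambda>w. ennreal (Y w)) w \<partial>M)"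
    using nn_cond_exp_intg[of "\<lambda>_. 1" "\<lambda>w. ennreal (Y w)"] Y(1) by simp
  also have "\<dots> \<le> (\<integral>\<^sup>+w. ennreal (Z w) \<partial>M)" by (rule nn_integral_mono_AE) (rule bound)
  also have "\<dots> = ennreal (\<integral>w. Z w \<partial>M)" by (intro nn_integral_eq_integral Z AE_I2)
  finally have le: "(\<integral>\<^sup>+w. ennreal (Y w) \<partial>M) \<le> ennreal (\<integral>w. Z w \<partial>M)" .
  then show int: "integrable M Y"
    using Y by (intro integrableI_nonneg) (auto intro: le_less_trans)
  have "ennreal (\<integral>w. Y w \<partial>M) \<le> ennreal (\<integral>w. Z w \<partial>M)"
    using le nn_integral_eq_integral[OF int] Y(2) by simp
  then show "(\<integral>w. Y w \<partial>M) \<le> (\<integral>w. Z w \<partial>M)"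
    using Z(2) by (simp add: integral_nonneg)
qed

lemma integrable_inner_of_squares:
  fixes X Y :: "'a \<Rightarrow> 'b::euclidean_space"
  assumes [measurable]: "X \<in> borel_measurable M" "Y \<in> borel_measurable M"
    and "integrable M (\<lambda>w. (norm (X w))\<^sup>2)" "integrable M (\<lambda>w. (norm (Y w))\<^sup>2)"
  shows "integrable M (\<lambda>w. X w \<bullet> Y w)"
proof (rule Bochner_Integration.integrable_bound)
  show "integrable M (\<lambda>w. (norm (X w))\<^sup>2 + (norm (Y w))\<^sup>2)" using assms by simp
  show "AE w in M. norm (X w \<bullet> Y w) \<le> norm ((norm (X w))\<^sup>2 + (norm (Y w))\<^sup>2)"
  proof (rule AE_I2)
    fix w
    have "\<bar>X w \<bullet> Y w\<bar> \<le> norm (X w) * norm (Y w)" by (rule Cauchy_Schwarz_ineq2)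
    also have "\<dots> \<le> (norm (X w))\<^sup>2 + (norm (Y w))\<^sup>2"
      using sum_squares_bound[of "norm (X w)" "norm (Y w)"]
        mult_nonneg_nonneg[OF norm_ge_zero[of "X w"] norm_ge_zero[of "Y w"]] by linarith
    finally show "norm (X w \<bullet> Y w) \<le> norm ((norm (X w))\<^sup>2 + (norm (Y w))\<^sup>2)" by simp
  qed
qed simp

lemma vec_nth_borel_measurable [measurable (raw)]:
  fixes f :: "'a \<Rightarrow> real^'n"
  assumes "f \<in> borel_measurable F"
  shows "(\<lambda>w. f w $ i) \<in> borel_measurable F"
  by (rule measurable_compose[OF assms])
    (intro borel_measurable_continuous_onI continuous_on_component continuous_on_id)

text \<open>\<open>X\<close> is measurable for the conditioning, so in the mean of
  \<open>X w \<bullet> g w\<close> the factor \<open>g\<close> may be replaced, component by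
  component, by its conditional expectation. The integrable minorant \<open>r\<close> stands in for
  the product with \<open>Y\<close>, whose measurability is not part of
  \<open>is_cond_exp\<close>.\<close>

lemma cond_exp_inner_lower_bound:
  fixes X g Y :: "'a \<Rightarrow> real^'n"
  assumes M: "prob_space M" and F: "subalgebra M F"
    and X: "X \<in> borel_measurable F" and g: "is_cond_exp M F g Y"
    and sq: "integrable M (\<lambda>w. (norm (X w))\<^sup>2)" "integrable M (\<lambda>w. (norm (g w))\<^sup>2)"
    and r: "integrable M r" "\<And>w. w \<in> space M \<Longrightarrow> r w \<le> X w \<bullet> Y w"
  shows "(\<integral>w. r w \<partial>M) \<le> (\<integral>w. X w \<bullet> g w \<partial>M)"
proof -
  interpret prob_space M by fact
  interpret finite_measure_subalgebra M F by unfold_locales (rule F)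
  have XM[measurable]: "X \<in> borel_measurable M" by (rule measurable_from_subalg[OF F X])
  have gM[measurable]: "g \<in> borel_measurable M" using g by (auto simp: is_cond_exp_def)
  have nth_sq: "integrable M (\<lambda>w. (norm (Z w $ i))\<^sup>2)"
    if "integrable M (\<lambda>w. (norm (Z w))\<^sup>2)" and [measurable]: "Z \<in> borel_measurable M"
    for Z :: "'a \<Rightarrow> real^'n" and i
  proof (rule Bochner_Integration.integrable_bound[OF that(1)])
    show "AE w in M. norm ((norm (Z w $ i))\<^sup>2) \<le> norm ((norm (Z w))\<^sup>2)"
      using power_mono[OF component_le_norm_cart, of _ i 2] by simp
  qed measurable
  \<comment> \<open>Pulling a component of \<open>X\<close> out of the conditional expectation
    requires this product to be integrable.\<close>
  have prod_int: "integrable M (\<lambda>w. X w $ i * g w $ i)" for i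
    using integrable_inner_of_squares[OF _ _ nth_sq[OF sq(1) XM] nth_sq[OF sq(2) gM], of i i]
    by simp
  let ?E = "\<lambda>i. real_cond_exp M F (\<lambda>w. g w $ i)"
  have [measurable]: "(\<lambda>w. X w $ i) \<in> borel_measurable F" for i
    using X by measurable
  have E: "integrable M (\<lambda>w. X w $ i * ?E i w)"
      "(\<integral>w. X w $ i * ?E i w \<partial>M) = (\<integral>w. X w $ i * g w $ i \<partial>M)" for i
    using real_cond_exp_intg[OF prod_int] by auto
  have "AE w in M. \<forall>i. ?E i w = Y w $ i"
    using g by (simp add: is_cond_exp_def AE_all_countable)
  then have "AE w in M. r w \<le> (\<Sum>i\<in>UNIV. X w $ i * ?E i w)"
    using AE_space by eventually_elim (use r(2) in \<open>simp add: inner_vec_def\<close>)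
  then have "(\<integral>w. r w \<partial>M) \<le> (\<integral>w. (\<Sum>i\<in>UNIV. X w $ i * ?E i w) \<partial>M)"
    using r(1) E(1) by (intro integral_mono_AE) auto
  also have "\<dots> = (\<integral>w. (\<Sum>i\<in>UNIV. X w $ i * g w $ i) \<partial>M)"
    using E prod_int by simp
  finally show ?thesis by (simp add: inner_vec_def)
qed

subsection \<open>Lyapunov recursion\<close>

text \<open>\<open>K / \<rho>\<close> is the fixed point of the affine map, and
  \<open>\<rho> \<le> 1\<close> makes the map monotone.\<close>

lemma affine_recursion_bound:
  fixes e :: "nat \<Rightarrow> real"
  assumes \<rho>: "0 < \<rho>" "\<rho> \<le> 1" and K: "0 \<le> K"
    and step: "\<And>t. e (Suc t) \<le> (1 - \<rho>) * e t + K"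
  shows "e t \<le> (1 - \<rho>) ^ t * e 0 + K / \<rho>"
proof (induction t)
  case 0
  then show ?case using \<rho> K by simp
next
  case (Suc t)
  have "e (Suc t) \<le> (1 - \<rho>) * e t + K" by (rule step)
  also have "\<dots> \<le> (1 - \<rho>) * ((1 - \<rho>) ^ t * e 0 + K / \<rho>) + K"
    using Suc \<rho> by (intro add_right_mono mult_left_mono) auto
  also have "\<dots> = (1 - \<rho>) ^ Suc t * e 0 + K / \<rho>"
    using \<rho> by (simp add: field_simps)
  finally show ?case .
qed

text \<open>Once terms are collected, \<open>small\<close> makes the coefficient of \<open>D\<close>
  nonpositive, \<open>rate\<close> merges the two contributions of \<open>s\<close> into
  \<open>W * (1 - \<beta>)\<close>, and each of the three remaining terms contracts at least at rate
  \<open>\<rho>\<close>.\<close>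

lemma lyapunov_step_arithmetic:
  fixes a b s D :: real
  assumes nn: "0 \<le> a" "0 \<le> b" "0 \<le> s" "0 \<le> D" "0 \<le> W" "0 < \<gamma>"
    and v: "v \<le> (1 - \<gamma> * \<mu>) * a - 2 * \<gamma> * D + \<gamma>\<^sup>2 * lam * (2 * A * D + B * s + C) + (1 - \<delta>) * b"
    and s': "s' \<le> 2 * At * D + Bt * s + Ct"
    and rate: "W * Bt + lam * B = W * (1 - \<beta>)"
    and small: "\<gamma> * (A * lam + W * At) \<le> 1"
    and \<rho>: "\<rho> \<le> \<gamma> * \<mu>" "\<rho> \<le> \<delta>" "\<rho> \<le> \<beta>"
  shows "v + \<gamma>\<^sup>2 * W * s' \<le> (1 - \<rho>) * (a + b + \<gamma>\<^sup>2 * W * s) + \<gamma>\<^sup>2 * (lam * C + W * Ct)"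
proof -
  have "\<gamma>\<^sup>2 * W * s' \<le> \<gamma>\<^sup>2 * W * (2 * At * D + Bt * s + Ct)"
    using s' nn by (intro mult_left_mono) auto
  with v have "v + \<gamma>\<^sup>2 * W * s' \<le> (1 - \<gamma> * \<mu>) * a + (1 - \<delta>) * b + \<gamma>\<^sup>2 * s * (W * Bt + lam * B)
      - 2 * \<gamma> * D * (1 - \<gamma> * (A * lam + W * At)) + \<gamma>\<^sup>2 * (lam * C + W * Ct)"
    by (simp add: algebra_simps power2_eq_square)
  moreover have "0 \<le> 2 * \<gamma> * D * (1 - \<gamma> * (A * lam + W * At))"
    using nn small by simp
  moreover have "\<gamma>\<^sup>2 * s * (W * Bt + lam * B) \<le> (1 - \<rho>) * (\<gamma>\<^sup>2 * W * s)"
  proof -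
    have "(1 - \<beta>) * (\<gamma>\<^sup>2 * W * s) \<le> (1 - \<rho>) * (\<gamma>\<^sup>2 * W * s)"
      using \<rho>(3) nn by (intro mult_right_mono) auto
    then show ?thesis unfolding rate by (simp add: algebra_simps)
  qed
  moreover have "(1 - \<gamma> * \<mu>) * a \<le> (1 - \<rho>) * a" "(1 - \<delta>) * b \<le> (1 - \<rho>) * b"
    using \<rho> nn by (auto intro!: mult_right_mono)
  moreover have "(1 - \<rho>) * (a + b + \<gamma>\<^sup>2 * W * s) = (1 - \<rho>) * a + (1 - \<rho>) * b + (1 - \<rho>) * (\<gamma>\<^sup>2 * W * s)"
    by (simp add: algebra_simps)
  ultimately show ?thesis by linarith
qed

lemma sqnorm_wrt_upper_bound:
  fixes L :: "real^'n^'n"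
  obtains K where "\<And>x. sqnorm_wrt L x \<le> K * (norm x)\<^sup>2"
proof -
  obtain K where K: "\<And>x. norm (L *v x) \<le> norm x * K"
    using bounded_linear.bounded[OF matrix_vector_mul_bounded_linear[of L]] by blast
  have "sqnorm_wrt L x \<le> K * (norm x)\<^sup>2" for x
  proof -
    have "sqnorm_wrt L x \<le> norm x * norm (L *v x)" unfolding sqnorm_wrt_def by (rule norm_cauchy_schwarz)
    also have "\<dots> \<le> norm x * (norm x * K)" by (intro mult_left_mono K) simp
    finally show ?thesis by (simp add: power2_eq_square mult_ac)
  qed
  then show ?thesis by (rule that)
qed

theorem theoremB2:
  fixes f :: "real^'n \<Rightarrow> real" and gf :: "real^'n \<Rightarrow> real^'n"
    and \<psi> :: "real^'n \<Rightarrow> ereal"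
    and L \<Omega> \<Omega>t :: "real^'n^'n"
    and xs hs x0 h0 :: "real^'n"
    and \<mu> \<omega> \<delta> \<gamma> A B C At Bt Ct W \<beta> lam \<sigma>0 :: real
    and M :: "'a measure" and S :: "'s measure" and R :: "'r measure"
    and C\<Omega> :: "'s \<Rightarrow> real^'n \<Rightarrow> real^'n" and C\<omega> :: "'r \<Rightarrow> real^'n \<Rightarrow> real^'n"
    and \<xi> :: "nat \<Rightarrow> 'a \<Rightarrow> 's" and \<eta> :: "nat \<Rightarrow> 'a \<Rightarrow> 'r"
    and x h g :: "nat \<Rightarrow> 'a \<Rightarrow> real^'n" and \<sigma> :: "nat \<Rightarrow> 'a \<Rightarrow> real"
  assumes grad: "\<And>y. GDERIV f y :> gf y"
    and \<mu>: "\<mu> > 0" "strongly_convex \<mu> f gf"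
    and L: "sym_mat L" "pd_mat L" "mat_smooth L f gf"
    and \<psi>: "proper_closed_convex \<psi>"
    and xs: "is_arg_min (\<lambda>y. ereal (f y) + \<psi> y) (\<lambda>_. True) xs"
    and hs: "hs = gf xs"
    and \<omega>: "\<omega> \<ge> 0"
    and \<Omega>: "sym_mat \<Omega>" "psd_mat \<Omega>"
    and C\<omega>: "scalar_compressor \<omega> R C\<omega>"
    and C\<Omega>: "matrix_compressor \<Omega> S C\<Omega>"
    and \<delta>: "\<delta> = 1 - 1 / (1 + lambda_min \<Omega>) * (1 - 1 / (1 + \<omega>)\<^sup>2)"
    and \<Omega>t: "\<Omega>t = mat 1 + (\<omega> * (\<omega> + 2)) *\<^sub>R (\<Omega> ** matrix_inv (mat 1 + \<Omega>))"
    and lam: "lam = lambda_max (L ** \<Omega>t)"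
    and M: "prob_space M"
    and fresh: "fresh_seeds M S R g \<sigma> \<xi> \<eta>"
    and run: "vr_gradskip_run M \<gamma> \<omega> \<Omega> \<psi> C\<Omega> C\<omega> \<xi> \<eta> g x0 h0 x h"
    and nonneg: "A \<ge> 0" "B \<ge> 0" "C \<ge> 0" "At \<ge> 0" "Bt \<ge> 0" "Ct \<ge> 0" "Bt < 1"
    and estimator: "gradient_estimator M f gf L xs A B C At Bt Ct x g \<sigma> \<sigma>0"
    and W_pos: "B > 0 \<Longrightarrow> W > lam * B / (1 - Bt)"
    and \<beta>_pos: "B > 0 \<Longrightarrow> \<beta> = 1 - Bt - lam * B / W"
    and W_zero: "B = 0 \<Longrightarrow> W = 0"
    and \<beta>_zero: "B = 0 \<Longrightarrow> \<beta> = 1 - Bt"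
    and \<gamma>: "\<gamma> > 0"
    and stepsize: "A * lam + W * At \<noteq> 0 \<Longrightarrow> \<gamma> \<le> 1 / (A * lam + W * At)"
  shows "\<forall>t. integrable M (\<lambda>w. lyapunov \<gamma> \<omega> W xs hs (x t w) (h t w) (\<sigma> t w)) \<and>
           (\<integral>w. lyapunov \<gamma> \<omega> W xs hs (x t w) (h t w) (\<sigma> t w) \<partial>M)
             \<le> (1 - Min {\<gamma> * \<mu>, \<delta>, \<beta>}) ^ t * lyapunov \<gamma> \<omega> W xs hs x0 h0 \<sigma>0
               + \<gamma>\<^sup>2 * ((lam * C + W * Ct) / Min {\<gamma> * \<mu>, \<delta>, \<beta>})"
proof -
  interpret prob_space M by fact
  define \<tau> where "\<tau> = \<gamma> * (1 + \<omega>)"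
  define \<kappa> where "\<kappa> = \<omega> * (\<omega> + 2)"
  define Q where "Q = matrix_inv (mat 1 + \<Omega>)"
  define \<rho> where "\<rho> = Min {\<gamma> * \<mu>, \<delta>, \<beta>}"
  have \<tau>: "\<tau> > 0" using \<gamma> \<omega> by (simp add: \<tau>_def)
  have \<kappa>: "\<kappa> \<ge> 0" using \<omega> by (simp add: \<kappa>_def)
  note firm = prox_firmly_nonexpansive_at_minimizer[OF \<psi> \<tau> grad[of xs, folded hs] xs]
  note Q = shift_matrix_inverse[OF \<Omega>, folded Q_def]
  note noise = noise_matrix_bound[OF \<Omega> L(1,2) \<kappa>, folded Q_def, unfolded \<kappa>_def,
      folded \<Omega>t[folded Q_def] lam, folded \<kappa>_def]
  have lam_pos: "lam > 0" by (rule noise(2))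

  \<comment> \<open>Signs and ranges of the constants\<close>
  have W: "W \<ge> 0" "W * Bt + lam * B = W * (1 - \<beta>)" and \<beta>: "0 < \<beta>" "\<beta> \<le> 1"
  proof -
    \<comment> \<open>The lower bound on \<open>W\<close> is a rearrangement of
      \<open>\<beta> > 0\<close>, and \<open>\<beta>\<close> is defined so that the rate identity
      holds. For \<open>B = 0\<close> both sides of that identity vanish because
      \<open>W = 0\<close>.\<close>
    have "W \<ge> 0 \<and> W * Bt + lam * B = W * (1 - \<beta>) \<and> 0 < \<beta> \<and> \<beta> \<le> 1"
    proof (cases "B > 0")
      case True
      have lb: "0 \<le> lam * B / (1 - Bt)" using lam_pos nonneg by simp
      then have Wpos: "W > 0" using W_pos[OF True] by linarith
      have "lam * B < W * (1 - Bt)"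
        using W_pos[OF True] nonneg by (simp add: pos_divide_less_eq)
      then have "lam * B / W < 1 - Bt" using Wpos by (simp add: pos_divide_less_eq mult.commute)
      moreover have "0 \<le> lam * B / W" using Wpos lam_pos nonneg by simp
      moreover have "W * Bt + lam * B = W * (Bt + lam * B / W)"
        using Wpos by (simp add: distrib_left)
      ultimately show ?thesis
        using \<beta>_pos[OF True] Wpos nonneg by simp
    next
      case False
      then have "B = 0" using nonneg by simp
      then show ?thesis using W_zero \<beta>_zero nonneg by simp
    qed
    then show "W \<ge> 0" "W * Bt + lam * B = W * (1 - \<beta>)" "0 < \<beta>" "\<beta> \<le> 1" by auto
  qed
  \<comment> \<open>The origin of \<open>\<delta>\<close>: the surplus
    \<open>\<gamma>\<^sup>2 * \<kappa>\<close>, damped by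
    \<open>1 / (1 + lambda_min \<Omega>)\<close>, is the fraction \<open>1 - \<delta>\<close> of the
    weight \<open>\<tau>\<^sup>2\<close>.\<close>
  have \<delta>_eq: "(1 - \<delta>) * \<tau>\<^sup>2 = \<gamma>\<^sup>2 * \<kappa> / (1 + lambda_min \<Omega>)"
  proof -
    have "(1 - 1 / (1 + \<omega>)\<^sup>2) * (1 + \<omega>)\<^sup>2 = (1 + \<omega>)\<^sup>2 - 1"
      using \<omega> by (simp add: left_diff_distrib)
    also have "\<dots> = \<kappa>" by (simp add: \<kappa>_def power2_eq_square algebra_simps)
    finally have "1 / (1 + lambda_min \<Omega>) * ((1 - 1 / (1 + \<omega>)\<^sup>2) * (1 + \<omega>)\<^sup>2) * \<gamma>\<^sup>2 =
        1 / (1 + lambda_min \<Omega>) * \<kappa> * \<gamma>\<^sup>2" by (simp only:)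
    then show ?thesis by (simp add: \<delta> \<tau>_def power_mult_distrib mult_ac)
  qed
  have \<delta>_pos: "0 < \<delta>"
  proof -
    define s where "s = 1 / (1 + \<omega>)\<^sup>2"
    define p where "p = 1 / (1 + lambda_min \<Omega>)"
    have sp: "0 < s" "s \<le> 1" "p \<le> 1" using \<omega> Q(4) by (auto simp: s_def p_def)
    then have "p * (1 - s) \<le> 1 * (1 - s)" by (intro mult_right_mono) auto
    also have "\<dots> < 1" using sp(1) by simp
    finally show ?thesis unfolding \<delta> s_def p_def by simp
  qed
  \<comment> \<open>The bound \<open>\<beta> \<le> 1\<close> caps the minimum, whatever the size of
    \<open>\<gamma> * \<mu>\<close>.\<close>
  have \<rho>: "0 < \<rho>" "\<rho> \<le> 1" "\<rho> \<le> \<gamma> * \<mu>" "\<rho> \<le> \<delta>" "\<rho> \<le> \<beta>"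
    using \<gamma> \<mu>(1) \<delta>_pos \<beta> by (auto simp: \<rho>_def)
  \<comment> \<open>If the denominator is zero, the stepsize is unrestricted and the claim reads
    \<open>0 \<le> 1\<close>.\<close>
  have small: "\<gamma> * (A * lam + W * At) \<le> 1"
  proof (cases "A * lam + W * At = 0")
    case False
    moreover have "0 \<le> A * lam + W * At" using nonneg lam_pos W(1) by simp
    ultimately show ?thesis using stepsize[OF False] by (simp add: field_simps)
  qed simp

  \<comment> \<open>Measurability of estimators and iterates\<close>
  note est = estimator[unfolded gradient_estimator_def]
  have gM: "\<And>t. g t \<in> borel_measurable M" and \<sigma>M: "\<And>t. \<sigma> t \<in> borel_measurable M"
    using est by auto
  note past = past_events_props[OF fresh gM \<sigma>M]
  let ?G = "past_events M S R g \<sigma> \<xi> \<eta>"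
  have ops: "randomized_operator S C\<Omega>" "randomized_operator R C\<omega>"
    using C\<Omega> C\<omega> by (auto simp: matrix_compressor_def scalar_compressor_def)
  note iter = iterates_measurable[OF fresh gM \<sigma>M run ops \<gamma> \<omega> firm(2)[unfolded \<tau>_def]]
  have G_pow: "?G t \<subseteq> Pow (space M)" for t using past(2)[of t] sets.space_closed[of M] by blast
  have G_sub: "subalgebra M (sigma (space M) (?G t))" for t
    using past(1,2)[of t] G_pow[of t]
    by (simp add: subalgebra_def space_measure_of_conv sigma_algebra.sigma_sets_eq)
  have xM: "x t \<in> borel_measurable M" and hM: "h t \<in> borel_measurable M" for t
    using iter[of t] measurable_from_subalg[OF G_sub] by blast+
  have gG: "g t \<in> borel_measurable (sigma (space M) (?G t))" for t
    by (rule measurable_wrt_generated[OF gM past(4) G_pow]) simp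
  note [measurable] = gM \<sigma>M xM hM

  \<comment> \<open>Estimates for the Bregman divergence\<close>
  have "continuous_on UNIV f"
    using grad by (metis continuous_at_imp_continuous_on gderiv_def has_derivative_continuous)
  then have [measurable]: "f \<in> borel_measurable borel" by (rule borel_measurable_continuous_onI)
  let ?D = "\<lambda>y. bregman f gf y xs"
  have D_nonneg: "0 \<le> ?D y" for y
    using \<mu> unfolding strongly_convex_def by (metis (no_types) divide_nonneg_nonneg less_imp_le
        mult_nonneg_nonneg order_trans zero_le_numeral zero_le_power2)
  obtain K where K: "\<And>y. sqnorm_wrt L y \<le> K * (norm y)\<^sup>2" using sqnorm_wrt_upper_bound by blast
  \<comment> \<open>Smoothness enters only here: a quadratic bound that makes the divergence
    integrable along the iterates.\<close>
  have D_upper: "?D y \<le> K / 2 * (norm (y - xs))\<^sup>2" for y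
  proof -
    have "?D y \<le> 1 / 2 * sqnorm_wrt L (y - xs)" using L(3) by (simp add: mat_smooth_def)
    also have "\<dots> \<le> 1 / 2 * (K * (norm (y - xs))\<^sup>2)" by (intro mult_left_mono K) simp
    finally show ?thesis by simp
  qed
  \<comment> \<open>The divergences of \<open>(y, xs)\<close> and \<open>(xs, y)\<close> add up to
    \<open>(gf y - hs) \<bullet> (y - xs)\<close>; strong convexity bounds the second and the first
    is kept.\<close>
  have monotone: "?D y + \<mu> / 2 * (norm (y - xs))\<^sup>2 + (y - xs) \<bullet> hs \<le> (y - xs) \<bullet> gf y" for y
  proof -
    have "\<mu> / 2 * (norm (xs - y))\<^sup>2 \<le> bregman f gf xs y"
      using \<mu>(2) by (simp add: strongly_convex_def)
    then show ?thesis
      by (simp add: bregman_def hs norm_minus_commute inner_diff_right inner_diff_left inner_commute)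
  qed

  \<comment> \<open>One step of the recursion, together with integrability\<close>
  let ?V = "\<lambda>t w. lyapunov \<gamma> \<omega> W xs hs (x t w) (h t w) (\<sigma> t w)"
  \<comment> \<open>The Bochner integral of a non-integrable function is 0 by default, so a
    recursion between means is informative only with integrability carried along.\<close>
  define good where "good t \<longleftrightarrow> integrable M (\<lambda>w. (norm (x t w - xs))\<^sup>2) \<and>
      integrable M (\<lambda>w. (norm (h t w - hs))\<^sup>2) \<and> integrable M (\<sigma> t)" for t
  have step: "good (Suc t) \<and> (\<integral>w. ?V (Suc t) w \<partial>M) \<le> (1 - \<rho>) * (\<integral>w. ?V t w \<partial>M) + \<gamma>\<^sup>2 * (lam * C + W * Ct)"
    if good: "good t" for t
  proof -
    let ?X = "\<lambda>w. x t w - xs" and ?d = "\<lambda>w. g t w - hs" and ?e = "\<lambda>w. h t w - hs"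
    let ?F = "gen_algebra M borel (x t)"
    let ?N = "\<lambda>w. sqnorm_wrt (matrix_inv L) (?d w)"
    have int: "integrable M (\<lambda>w. (norm (?X w))\<^sup>2)" "integrable M (\<lambda>w. (norm (?e w))\<^sup>2)" "integrable M (\<sigma> t)"
      using good by (auto simp: good_def)
    have F: "subalgebra M ?F" by (rule gen_algebra_subalgebra[OF xM])
    have D_int: "integrable M (\<lambda>w. ?D (x t w))"
    proof (rule Bochner_Integration.integrable_bound)
      show "integrable M (\<lambda>w. K / 2 * (norm (?X w))\<^sup>2)" using int(1) by simp
      show "AE w in M. norm (?D (x t w)) \<le> norm (K / 2 * (norm (?X w))\<^sup>2)"
        by (intro AE_I2, simp only: real_norm_def abs_of_nonneg[OF D_nonneg])
          (rule order_trans[OF D_upper abs_ge_self])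
    qed (simp add: bregman_def)
    have \<sigma>_nonneg: "\<And>w t. w \<in> space M \<Longrightarrow> 0 \<le> \<sigma> t w" using est by auto
    have N_nonneg: "0 \<le> ?N w" for w
      using pd_mat_inverse(4)[OF L(1,2)] unfolding pd_mat_def sqnorm_wrt_def
      by (cases "?d w = 0") (auto intro: less_imp_le)
    have N_meas: "?N \<in> borel_measurable M" unfolding sqnorm_wrt_def by measurable
    have Z_int: "integrable M (\<lambda>w. 2 * a * ?D (x t w) + b * \<sigma> t w + c)" for a b c
      using D_int int(3) by simp
    have Z_nonneg: "0 \<le> 2 * a * ?D (x t w) + b * \<sigma> t w + c"
      if "0 \<le> a" "0 \<le> b" "0 \<le> c" "w \<in> space M" for a b c w
      using that D_nonneg \<sigma>_nonneg by (intro add_nonneg_nonneg mult_nonneg_nonneg) auto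
    have "AE w in M. nn_cond_exp M ?F (\<lambda>w. ennreal (?N w)) w
        \<le> ennreal (2 * A * ?D (x t w) + B * \<sigma> t w + C)"
      using est unfolding hs by blast
    note N = integrable_of_nn_cond_exp_bound[OF M F N_meas N_nonneg Z_int Z_nonneg[OF nonneg(1-3)] this]
    have "AE w in M. nn_cond_exp M ?F (\<lambda>w. ennreal (\<sigma> (Suc t) w)) w
        \<le> ennreal (2 * At * ?D (x t w) + Bt * \<sigma> t w + Ct)"
      using est by blast
    note \<sigma>' = integrable_of_nn_cond_exp_bound[OF M F \<sigma>M \<sigma>_nonneg Z_int Z_nonneg[OF nonneg(4-6)] this]
    let ?q = "\<lambda>w. ?d w \<bullet> ?d w - ?d w \<bullet> (Q *v ?d w)"
    have q_nonneg: "0 \<le> ?q w" for w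
    proof -
      have "(norm (?d w))\<^sup>2 / (1 + lambda_min \<Omega>) \<le> (norm (?d w))\<^sup>2"
        using Q(4) by (simp add: divide_le_eq mult_left_le field_simps)
      then show ?thesis using Q(5)[of "?d w"] by (simp add: power2_norm_eq_inner)
    qed
    \<comment> \<open>As \<open>\<kappa> * ?q w\<close> is nonnegative, the noise bound alone
      dominates the squared error by \<open>lam * ?N w\<close>, whose mean the estimator assumption
      controls.\<close>
    have d_int: "integrable M (\<lambda>w. (norm (?d w))\<^sup>2)"
    proof (rule Bochner_Integration.integrable_bound)
      show "integrable M (\<lambda>w. lam * ?N w)" using N(1) by simp
      show "AE w in M. norm ((norm (?d w))\<^sup>2) \<le> norm (lam * ?N w)"
      proof (rule AE_I2)
        fix w
        have "0 \<le> \<kappa> * ?q w" using \<kappa> q_nonneg by simp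
        then have "(norm (?d w))\<^sup>2 \<le> lam * ?N w"
          using noise(1)[of "?d w"] by (simp add: power2_norm_eq_inner)
        then show "norm ((norm (?d w))\<^sup>2) \<le> norm (lam * ?N w)" by simp
      qed
    qed measurable
    have g_int: "integrable M (\<lambda>w. (norm (g t w))\<^sup>2)"
    proof (rule Bochner_Integration.integrable_bound)
      show "integrable M (\<lambda>w. 2 * (norm (?d w))\<^sup>2 + 2 * (norm hs)\<^sup>2)" using d_int by simp
      show "AE w in M. norm ((norm (g t w))\<^sup>2) \<le> norm (2 * (norm (?d w))\<^sup>2 + 2 * (norm hs)\<^sup>2)"
      proof (rule AE_I2)
        fix w
        have "(norm (g t w))\<^sup>2 \<le> (norm (?d w) + norm hs)\<^sup>2"
          using norm_triangle_ineq[of "?d w" hs] by (intro power_mono) auto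
        also have "\<dots> \<le> 2 * (norm (?d w))\<^sup>2 + 2 * (norm hs)\<^sup>2"
          using sum_squares_bound[of "norm (?d w)" "norm hs"] by (simp add: power2_sum)
        finally show "norm ((norm (g t w))\<^sup>2) \<le> norm (2 * (norm (?d w))\<^sup>2 + 2 * (norm hs)\<^sup>2)" by simp
      qed
    qed measurable
    have const_int: "integrable M (\<lambda>w. (norm hs)\<^sup>2)" by simp
    have Xd_int: "integrable M (\<lambda>w. ?X w \<bullet> ?d w)" and Xg_int: "integrable M (\<lambda>w. ?X w \<bullet> g t w)"
      and Xhs_int: "integrable M (\<lambda>w. ?X w \<bullet> hs)"
      using int(1) d_int g_int const_int by (auto intro!: integrable_inner_of_squares)
    have X_F: "?X \<in> borel_measurable ?F"
      unfolding gen_algebra_def by (intro borel_measurable_diff measurable_vimage_algebra1) auto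
    \<comment> \<open>The pointwise inequality \<open>monotone\<close> passes through the
      conditional mean of \<open>g t\<close>; the term with \<open>hs\<close> then turns
      \<open>g t w\<close> into \<open>?d w\<close>.\<close>
    have cross: "(\<integral>w. ?D (x t w) \<partial>M) + \<mu> / 2 * (\<integral>w. (norm (?X w))\<^sup>2 \<partial>M) \<le> (\<integral>w. ?X w \<bullet> ?d w \<partial>M)"
    proof -
      have "(\<integral>w. ?D (x t w) + \<mu> / 2 * (norm (?X w))\<^sup>2 + ?X w \<bullet> hs \<partial>M) \<le> (\<integral>w. ?X w \<bullet> g t w \<partial>M)"
      proof (rule cond_exp_inner_lower_bound[OF M F X_F _ int(1) g_int])
        show "is_cond_exp M ?F (g t) (\<lambda>w. gf (x t w))" using est by blast
        show "integrable M (\<lambda>w. ?D (x t w) + \<mu> / 2 * (norm (?X w))\<^sup>2 + ?X w \<bullet> hs)"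
          using D_int int(1) Xhs_int by simp
      qed (rule monotone)
      then show ?thesis
        using D_int int(1) Xhs_int Xg_int by (simp add: inner_diff_right)
    qed
    let ?U = "\<lambda>w. (norm (?X w - \<gamma> *\<^sub>R ?d w))\<^sup>2 + \<gamma>\<^sup>2 * \<kappa> * (?q w + ?e w \<bullet> (Q *v ?e w))"
    \<comment> \<open>Here the noise bound has absorbed \<open>?d w \<bullet> ?d w\<close> and
      \<open>?q w\<close>, and \<open>\<delta>_eq\<close> has rewritten the shift term, so each mean
      is either controlled or part of the Lyapunov function.\<close>
    let ?U' = "\<lambda>w. (norm (?X w))\<^sup>2 - 2 * \<gamma> * (?X w \<bullet> ?d w) + \<gamma>\<^sup>2 * lam * ?N w + (1 - \<delta>) * \<tau>\<^sup>2 * (norm (?e w))\<^sup>2"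
    have UU': "?U w \<le> ?U' w" for w
    proof -
      have "(norm (?X w - \<gamma> *\<^sub>R ?d w))\<^sup>2 = (norm (?X w))\<^sup>2 - 2 * \<gamma> * (?X w \<bullet> ?d w) + \<gamma>\<^sup>2 * (?d w \<bullet> ?d w)"
        unfolding power2_norm_eq_inner[of "?X w - \<gamma> *\<^sub>R ?d w"] power2_norm_eq_inner[of "?X w"]
          inner_diff_left[of "?X w"] inner_diff_right[of _ "?X w"]
        by (simp add: inner_commute[of "?d w" "?X w"] power2_eq_square)
      moreover have "\<gamma>\<^sup>2 * (?d w \<bullet> ?d w + \<kappa> * ?q w) \<le> \<gamma>\<^sup>2 * (lam * ?N w)"
        using noise(1)[of "?d w"] by (intro mult_left_mono) auto
      moreover have "\<gamma>\<^sup>2 * \<kappa> * (?e w \<bullet> (Q *v ?e w)) \<le> \<gamma>\<^sup>2 * \<kappa> * ((norm (?e w))\<^sup>2 / (1 + lambda_min \<Omega>))"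
        using Q(5) \<kappa> by (intro mult_left_mono) auto
      moreover have "\<gamma>\<^sup>2 * \<kappa> * ((norm (?e w))\<^sup>2 / (1 + lambda_min \<Omega>)) = (1 - \<delta>) * \<tau>\<^sup>2 * (norm (?e w))\<^sup>2"
        unfolding \<delta>_eq by simp
      moreover have "\<gamma>\<^sup>2 * (?d w \<bullet> ?d w + \<kappa> * ?q w) = \<gamma>\<^sup>2 * (?d w \<bullet> ?d w) + \<gamma>\<^sup>2 * \<kappa> * ?q w"
        "\<gamma>\<^sup>2 * \<kappa> * (?q w + ?e w \<bullet> (Q *v ?e w)) = \<gamma>\<^sup>2 * \<kappa> * ?q w + \<gamma>\<^sup>2 * \<kappa> * (?e w \<bullet> (Q *v ?e w))"
        "\<gamma>\<^sup>2 * (lam * ?N w) = \<gamma>\<^sup>2 * lam * ?N w"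
        by (simp_all only: distrib_left mult.assoc)
      ultimately show ?thesis by linarith
    qed
    \<comment> \<open>Through \<open>UU'\<close> this also gives the sign of \<open>?U'\<close>,
      which its own form does not show and which the passage from \<open>ennreal\<close> to real
      integrals requires.\<close>
    have U_nonneg: "0 \<le> ?U w" for w
    proof -
      have "0 \<le> ?e w \<bullet> (Q *v ?e w)"
        using Q(2) unfolding pd_mat_def by (cases "?e w = 0") (auto intro: less_imp_le)
      then show ?thesis using q_nonneg[of w] \<kappa> by (intro add_nonneg_nonneg mult_nonneg_nonneg) auto
    qed
    have U'_int: "integrable M ?U'" using int Xd_int N(1) by simp
    let ?v = "\<lambda>w. (norm (x (Suc t) w - xs))\<^sup>2 + \<gamma>\<^sup>2 * (1 + \<omega>)\<^sup>2 * (norm (h (Suc t) w - hs))\<^sup>2"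
    have stp: "(x (Suc t) w, h (Suc t) w) =
        vr_gradskip_step \<gamma> \<omega> \<Omega> \<psi> (C\<Omega> (\<xi> t w)) (C\<omega> (\<eta> t w)) (g t w) (x t w, h t w)" if "w \<in> space M" for w
      using run that by (simp add: vr_gradskip_run_def)
    note fr = fresh[unfolded fresh_seeds_def, rule_format, of t]
    have "(\<integral>\<^sup>+w. ennreal (?v w) \<partial>M) \<le> (\<integral>\<^sup>+w. ennreal (?U w) \<partial>M)"
      unfolding Q_def \<kappa>_def
      by (rule vr_gradskip_step_expectation[OF M C\<omega> C\<Omega> \<Omega> \<gamma> \<omega> _ _ _ _ past(1) _ _ _ _ gG
            firm(2)[unfolded \<tau>_def] firm(1)[unfolded \<tau>_def] stp])
        (use fr iter[of t] in blast)+
    also have "\<dots> \<le> (\<integral>\<^sup>+w. ennreal (?U' w) \<partial>M)"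
      using UU' by (intro nn_integral_mono ennreal_leI)
    also have "\<dots> = ennreal (\<integral>w. ?U' w \<partial>M)"
      using U_nonneg UU' by (intro nn_integral_eq_integral U'_int AE_I2) (rule order_trans)
    finally have le: "(\<integral>\<^sup>+w. ennreal (?v w) \<partial>M) \<le> ennreal (\<integral>w. ?U' w \<partial>M)" .
    have v_nonneg: "0 \<le> ?v w" for w by simp
    have v_int: "integrable M ?v"
      using le by (intro integrableI_nonneg AE_I2 v_nonneg) (auto intro: le_less_trans)
    have "ennreal (\<integral>w. ?v w \<partial>M) \<le> ennreal (\<integral>w. ?U' w \<partial>M)"
      using le nn_integral_eq_integral[OF v_int] by simp
    moreover have "0 \<le> (\<integral>w. ?U' w \<partial>M)"
      using U_nonneg UU' by (intro integral_nonneg_AE AE_I2) (rule order_trans)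
    ultimately have v_le: "(\<integral>w. ?v w \<partial>M) \<le> (\<integral>w. ?U' w \<partial>M)" by simp
    \<comment> \<open>Each summand of \<open>?v\<close> is nonnegative and hence dominated by the
      integrable sum.\<close>
    have x'_int: "integrable M (\<lambda>w. (norm (x (Suc t) w - xs))\<^sup>2)"
      by (rule Bochner_Integration.integrable_bound[OF v_int]) (auto intro!: AE_I2)
    have "integrable M (\<lambda>w. \<gamma>\<^sup>2 * (1 + \<omega>)\<^sup>2 * (norm (h (Suc t) w - hs))\<^sup>2)"
      by (rule Bochner_Integration.integrable_bound[OF v_int]) (auto intro!: AE_I2)
    then have h'_int: "integrable M (\<lambda>w. (norm (h (Suc t) w - hs))\<^sup>2)" using \<gamma> \<omega> by simp
    have "good (Suc t)" using x'_int h'_int \<sigma>'(1) by (simp add: good_def)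
    moreover
    let ?a = "\<integral>w. (norm (?X w))\<^sup>2 \<partial>M" and ?b = "\<tau>\<^sup>2 * (\<integral>w. (norm (?e w))\<^sup>2 \<partial>M)"
      and ?s = "\<integral>w. \<sigma> t w \<partial>M" and ?DD = "\<integral>w. ?D (x t w) \<partial>M"
    have "(\<integral>w. ?v w \<partial>M) \<le> (1 - \<gamma> * \<mu>) * ?a - 2 * \<gamma> * ?DD + \<gamma>\<^sup>2 * lam * (2 * A * ?DD + B * ?s + C) + (1 - \<delta>) * ?b"
    proof -
      \<comment> \<open>\<open>cross\<close> now supplies the contraction by
        \<open>\<gamma> * \<mu>\<close> and the negative divergence term that will absorb the one
        from the estimator bound.\<close>
      have "(\<integral>w. ?U' w \<partial>M) = ?a - 2 * \<gamma> * (\<integral>w. ?X w \<bullet> ?d w \<partial>M) + \<gamma>\<^sup>2 * lam * (\<integral>w. ?N w \<partial>M) + (1 - \<delta>) * ?b"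
        using int Xd_int N(1) by simp
      moreover have "2 * \<gamma> * (?DD + \<mu> / 2 * ?a) \<le> 2 * \<gamma> * (\<integral>w. ?X w \<bullet> ?d w \<partial>M)"
        using cross \<gamma> by (intro mult_left_mono) auto
      moreover have "\<gamma>\<^sup>2 * lam * (\<integral>w. ?N w \<partial>M) \<le> \<gamma>\<^sup>2 * lam * (2 * A * ?DD + B * ?s + C)"
        using N(2) D_int int(3) lam_pos by (intro mult_left_mono) (auto simp: prob_space)
      moreover have "2 * \<gamma> * (?DD + \<mu> / 2 * ?a) = 2 * \<gamma> * ?DD + \<gamma> * \<mu> * ?a"
        "(1 - \<gamma> * \<mu>) * ?a = ?a - \<gamma> * \<mu> * ?a"
        by (simp_all add: algebra_simps)
      ultimately show ?thesis using v_le by linarith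
    qed
    moreover have "(\<integral>w. \<sigma> (Suc t) w \<partial>M) \<le> 2 * At * ?DD + Bt * ?s + Ct"
      using \<sigma>'(2) D_int int(3) by (simp add: prob_space)
    moreover have "0 \<le> ?a" "0 \<le> ?b" "0 \<le> ?s" "0 \<le> ?DD"
      using D_nonneg \<sigma>_nonneg by (auto intro!: integral_nonneg_AE)
    ultimately have "(\<integral>w. ?v w \<partial>M) + \<gamma>\<^sup>2 * W * (\<integral>w. \<sigma> (Suc t) w \<partial>M) \<le>
        (1 - \<rho>) * (?a + ?b + \<gamma>\<^sup>2 * W * ?s) + \<gamma>\<^sup>2 * (lam * C + W * Ct)"
      by (intro lyapunov_step_arithmetic[OF _ _ _ _ W(1) \<gamma> _ _ W(2) small \<rho>(3-5)])
    moreover have "(\<integral>w. ?V (Suc t) w \<partial>M) = (\<integral>w. ?v w \<partial>M) + \<gamma>\<^sup>2 * W * (\<integral>w. \<sigma> (Suc t) w \<partial>M)"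
      using v_int \<sigma>'(1) unfolding lyapunov_def by simp
    moreover have "(\<integral>w. ?V t w \<partial>M) = ?a + ?b + \<gamma>\<^sup>2 * W * ?s"
      using int unfolding lyapunov_def \<tau>_def by (simp add: power_mult_distrib)
    ultimately show ?thesis using \<open>good (Suc t)\<close> by simp
  qed

  \<comment> \<open>Initial values and conclusion\<close>
  have init: "x 0 w = x0" "h 0 w = h0" "\<sigma> 0 w = \<sigma>0" if "w \<in> space M" for w
    using that run est by (auto simp: vr_gradskip_run_def)
  \<comment> \<open>The initial state is constant on \<open>space M\<close>, hence integrable for a
    probability measure.\<close>
  have "good 0 \<longleftrightarrow> integrable M (\<lambda>w. (norm (x0 - xs))\<^sup>2) \<and> integrable M (\<lambda>w. (norm (h0 - hs))\<^sup>2) \<and>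
      integrable M (\<lambda>w. \<sigma>0)"
    unfolding good_def
    by (intro arg_cong2[where f = "(\<and>)"] Bochner_Integration.integrable_cong) (simp_all add: init)
  then have "good 0" by simp
  then have good: "good t" for t by (induction t) (use step in auto)
  have V0: "(\<integral>w. ?V 0 w \<partial>M) = lyapunov \<gamma> \<omega> W xs hs x0 h0 \<sigma>0"
  proof -
    have "(\<integral>w. ?V 0 w \<partial>M) = (\<integral>w. lyapunov \<gamma> \<omega> W xs hs x0 h0 \<sigma>0 \<partial>M)"
      by (rule Bochner_Integration.integral_cong) (simp_all add: init)
    then show ?thesis by (simp add: prob_space)
  qed
  have K_nonneg: "0 \<le> \<gamma>\<^sup>2 * (lam * C + W * Ct)" using lam_pos W(1) nonneg by simp
  show ?thesis
  proof (intro allI conjI)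
    fix t
    show "integrable M (?V t)" using good[of t] by (simp add: good_def lyapunov_def)
    show "(\<integral>w. ?V t w \<partial>M) \<le> (1 - Min {\<gamma> * \<mu>, \<delta>, \<beta>}) ^ t * lyapunov \<gamma> \<omega> W xs hs x0 h0 \<sigma>0
               + \<gamma>\<^sup>2 * ((lam * C + W * Ct) / Min {\<gamma> * \<mu>, \<delta>, \<beta>})"
      using affine_recursion_bound[OF \<rho>(1,2) K_nonneg, of "\<lambda>t. \<integral>w. ?V t w \<partial>M" t] step good
      unfolding V0 \<rho>_def by simp
  qed
qed

end
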